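(* Let $k\geq t+2\geq 4$, $n\geq 7(k-t+1)k^2$, and let $\mathcal{F},\mathcal{G}\subseteq\binom{[n]}{k}$ be cross $t$-intersecting. Suppose that $$|\mathcal{F}|\geq|\mathcal{L}(n,k,t,u,v)|\quad\text{and}\quad|\mathcal{G}|\geq|\mathcal{L}(n,k,t,v,u)|$$ for some integers $u,v\in[3,k-t+1]$ with $(u,v)\neq(3,3)$. Then at least one of the following holds: (a) $\gamma_t(\mathcal{F})\leq\gamma_t(\mathcal{L}(n,k,t,u,v))$ and $\gamma_t(\mathcal{G})\leq\gamma_t(\mathcal{L}(n,k,t,v,u))$; (b) $u,v\leq t+2$ and $\mathcal{F},\mathcal{G}\subseteq\mathcal{A}(Z)$ for some $Z\in\binom{[n]}{t+2}$. Moreover, in case (a), if $\gamma_t(\mathcal{F})=\gamma_t(\mathcal{L}(n,k,t,u,v))$ or $\gamma_t(\mathcal{G})=\gamma_t(\mathcal{L}(n,k,t,v,u))$, then $\mathcal{F}=\mathcal{L}(X,U,V)$ and $\mathcal{G}=\mathcal{L}(X,V,U)$ for some $X\in\binom{[n]}{t}$, $U\in\binom{[n]}{t+u}$ and $V\in\binom{[n]}{t+v}$ with $X\subseteq U\cap V$ and $|U\cap V|\geq t+2$.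
   Context: $n,k,t$ are positive integers, $[n]=\{1,\dots,n\}$, $[i,j]=\{i,i+1,\dots,j\}$, and $\binom{[n]}{k}$ is the family of all $k$-subsets of $[n]$. Families $\mathcal{F},\mathcal{G}$ are cross $t$-intersecting if $|F\cap G|\ge t$ for all $F\in\mathcal{F}$, $G\in\mathcal{G}$. For a family $\mathcal{F}$ of subsets of $[n]$, $\Delta_t(\mathcal{F})=\max\{|\{F\in\mathcal{F}:S\subseteq F\}|:S\in\binom{[n]}{t}\}$ and the $t$-diversity is $\gamma_t(\mathcal{F}):=|\mathcal{F}|-\Delta_t(\mathcal{F})$. For $Z\in\binom{[n]}{t+2}$, $\mathcal{A}(Z)=\{F\in\binom{[n]}{k}:|F\cap Z|\geq t+1\}$. For $X\in\binom{[n]}{t}$, $U\in\binom{[n]}{t+u}$ and $V\in\binom{[n]}{t+v}$ with $X\subseteq U\cap V$, $$\mathcal{L}(X,U,V)=\left\{F\in\binom{[n]}{k}:X\subseteq F,\ F\cap(V\setminus X)\neq\emptyset\right\}\cup\left\{F\in\binom{[n]}{k}:F\cap U=U\setminus\{x\}\text{ for some }x\in X\right\},$$ and $\mathcal{L}(n,k,t,u,v)=\mathcal{L}([t],[t+u],[t+v])$. One has $|\mathcal{L}(n,k,t,u,v)|=\binom{n-t}{k-t}-\binom{n-v-t}{k-t}+t\binom{n-u-t}{k-u-t+1}$ and $\gamma_t(\mathcal{L}(n,k,t,u,v))=t\binom{n-u-t}{k-u-t+1}$. *)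

theory Defs
  imports "HOL-Library.Ramsey"
begin

text \<open>
  The ground set is \<^term>\<open>{1..n::nat}\<close>, and \<open>[{1..n}]\<^bsup>k\<^esup>\<close> (the library's \<^const>\<open>nsets\<close>)
  is the family of all its k-element subsets.
\<close>

definition cross_t_intersecting :: "nat \<Rightarrow> nat set set \<Rightarrow> nat set set \<Rightarrow> bool" where
  "cross_t_intersecting t \<F> \<G> \<longleftrightarrow> (\<forall>F\<in>\<F>. \<forall>G\<in>\<G>. t \<le> card (F \<inter> G))"

text \<open>The maximum is meaningful for \<^prop>\<open>t \<le> n\<close>, when there is at least one t-subset.\<close>

definition max_t_degree :: "nat \<Rightarrow> nat \<Rightarrow> nat set set \<Rightarrow> nat" where
  "max_t_degree n t \<F> = Max ((\<lambda>S. card {F \<in> \<F>. S \<subseteq> F}) ` [{1..n}]\<^bsup>t\<^esup>)"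

text \<open>
  For a finite family the degree of a t-set is at most the size of the family, so the
  subtraction on natural numbers below does not truncate.
\<close>

definition t_diversity :: "nat \<Rightarrow> nat \<Rightarrow> nat set set \<Rightarrow> nat" where
  "t_diversity n t \<F> = card \<F> - max_t_degree n t \<F>"

definition A_family :: "nat \<Rightarrow> nat \<Rightarrow> nat \<Rightarrow> nat set \<Rightarrow> nat set set" where
  "A_family n k t Z = {F \<in> [{1..n}]\<^bsup>k\<^esup>. t + 1 \<le> card (F \<inter> Z)}"

definition L_family :: "nat \<Rightarrow> nat \<Rightarrow> nat set \<Rightarrow> nat set \<Rightarrow> nat set \<Rightarrow> nat set set" where
  "L_family n k X U V =
     {F \<in> [{1..n}]\<^bsup>k\<^esup>. X \<subseteq> F \<and> F \<inter> (V - X) \<noteq> {}} \<union>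
     {F \<in> [{1..n}]\<^bsup>k\<^esup>. \<exists>x\<in>X. F \<inter> U = U - {x}}"

definition L_std :: "nat \<Rightarrow> nat \<Rightarrow> nat \<Rightarrow> nat \<Rightarrow> nat \<Rightarrow> nat set set" where
  "L_std n k t u v = L_family n k {1..t} {1..t + u} {1..t + v}"

end

theory Submission
  imports Defs Complex_Main
begin

text \<open>
  Peeling: starting from the pair $(\mathcal F,\mathcal G)$, replace each family alternately by the
  t-covers of the other one of size smaller by one. A set lost in the step from size $j$ to $j-1$
  contains a minimal t-cover of size $j$ of a family of sets of size at most $j$; branching over
  that family leaves at most ${j \choose t}(j-t+1)^{j-t}$ such covers, so for this range of $n$ all
  losses together are less than $18/25$ of the number ${n-t-1 \choose k-t-1}$ of k-sets through a
  fixed (t+1)-set. What remains is generated by two cross t-intersecting families of (t+1)-sets.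
  By the size hypotheses one of these has at least three members and the other at least four,
  which forces all of them either to contain a common t-set X or to lie in a common (t+2)-set Z.

  If they lie in Z, a member outside the family of Z would leave the other family too small,
  and every t-degree is at most $2{n-t-1 \choose k-t-1}$, so the diversity is large. If they contain X, the
  members of one family that miss part of X must share at least u points outside X, since
  otherwise too few members of the other family could meet them; this bounds the diversity
  and identifies the extremal case.
\<close>

text \<open>All sizes are compared with \<open>d1\<close>, the number of k-sets through a (t+1)-set.
  The bound on n makes the degree drop by a factor of at least 7 k^2 from s-sets to (s+1)-sets for
  t+1 \<le> s < k. Hence sets that all contain one of at most k^2 given (t+2)-sets number at most
  \<open>d1 / 7\<close>, which is how every exceptional family is discarded. The constant 18/25 is
  needed most sharply when a set outside \<open>A_family n k t Z\<close> is excluded: 18/25 + 2 +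
  1/7 must stay below 3 - 1/14. The case u = v = 3 is a genuine obstacle. For a set Y of size t-1
  and four further points a, b, c, d, the families {Y+ab, Y+ad, Y+cd} and {Y+ac, Y+ad, Y+bd} are
  cross t-intersecting, with three members each, but have neither a common t-subset nor a common
  (t+2)-superset. A fourth member on one side destroys this pattern. The assumption t \<ge> 2
  supplies two distinct points of X, and these turn cross-intersection of the extremal pair into |U
  \<inter> V| \<ge> t+2.\<close>

section \<open>Counting k-sets through a fixed set\<close>

lemma card_nsets_between:
  assumes "finite A" "S \<subseteq> A" "R \<subseteq> A" "S \<inter> R = {}" "card S \<le> k"
  shows "card {F \<in> [A]\<^bsup>k\<^esup>. S \<subseteq> F \<and> F \<inter> R = {}} = (card A - card S - card R) choose (k - card S)"
proof -
  have fS: "finite S" and fR: "finite R"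
    using assms finite_subset by blast+
  have "bij_betw (\<lambda>F. F - S) {F \<in> [A]\<^bsup>k\<^esup>. S \<subseteq> F \<and> F \<inter> R = {}} ([A - S - R]\<^bsup>(k - card S)\<^esup>)"
  proof (rule bij_betw_byWitness[where f' = "\<lambda>F. F \<union> S"])
    show "(\<lambda>F. F - S) ` {F \<in> [A]\<^bsup>k\<^esup>. S \<subseteq> F \<and> F \<inter> R = {}} \<subseteq> [A - S - R]\<^bsup>(k - card S)\<^esup>"
      using fS by (auto simp: nsets_def card_Diff_subset)
    show "(\<lambda>F. F \<union> S) ` ([A - S - R]\<^bsup>(k - card S)\<^esup>) \<subseteq> {F \<in> [A]\<^bsup>k\<^esup>. S \<subseteq> F \<and> F \<inter> R = {}}"
    proof
      fix E assume "E \<in> (\<lambda>F. F \<union> S) ` ([A - S - R]\<^bsup>(k - card S)\<^esup>)"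
      then obtain F where F: "F \<subseteq> A - S - R" "finite F" "card F = k - card S" "E = F \<union> S"
        by (auto simp: nsets_def)
      have "card E = card F + card S"
        unfolding F(4) by (rule card_Un_disjoint) (use F fS in auto)
      with F assms fS show "E \<in> {F \<in> [A]\<^bsup>k\<^esup>. S \<subseteq> F \<and> F \<inter> R = {}}"
        by (auto simp: nsets_def)
    qed
  qed (auto simp: nsets_def)
  then have "card {F \<in> [A]\<^bsup>k\<^esup>. S \<subseteq> F \<and> F \<inter> R = {}} = card (A - S - R) choose (k - card S)"
    by (simp add: bij_betw_same_card)
  also have "card (A - S - R) = card A - card S - card R"
  proof -
    have "card (A - S - R) = card (A - S) - card R"
      using assms fR by (intro card_Diff_subset) auto
    then show ?thesis using assms fS by (simp add: card_Diff_subset)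
  qed
  finally show ?thesis .
qed

declare finite_imp_finite_nsets [simp]

definition star :: "nat \<Rightarrow> nat \<Rightarrow> nat set \<Rightarrow> nat set set" where
  "star n k S = {F \<in> [{1..n}]\<^bsup>k\<^esup>. S \<subseteq> F}"

lemma finite_star [simp]: "finite (star n k S)"
  by (simp add: star_def)

lemma card_star_le: "card (star n k S) \<le> (n - card S) choose (k - card S)"
proof (cases "S \<subseteq> {1..n} \<and> card S \<le> k")
  case True
  then show ?thesis
    using card_nsets_between[of "{1..n}" S "{}" k] by (simp add: star_def)
next
  case False
  have "star n k S = {}"
  proof (rule ccontr)
    assume "star n k S \<noteq> {}"
    then obtain F where "F \<subseteq> {1..n}" "finite F" "card F = k" "S \<subseteq> F"
      by (auto simp: star_def nsets_def)
    then show False using False card_mono by fastforce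
  qed
  then show ?thesis by simp
qed

lemma card_UN_star_le:
  assumes "finite \<T>" "\<And>T. T \<in> \<T> \<Longrightarrow> card T = s"
  shows "card (\<Union>T\<in>\<T>. star n k T) \<le> card \<T> * ((n - s) choose (k - s))"
proof -
  have "card (\<Union>T\<in>\<T>. star n k T) \<le> (\<Sum>T\<in>\<T>. card (star n k T))"
    by (rule card_UN_le[OF assms(1)])
  also have "\<dots> \<le> (\<Sum>T\<in>\<T>. (n - s) choose (k - s))"
    using card_star_le assms(2) by (intro sum_mono) metis
  finally show ?thesis by simp
qed

section \<open>Minimal t-covers\<close>

definition t_cover :: "nat \<Rightarrow> nat set set \<Rightarrow> nat set \<Rightarrow> bool" where
  "t_cover t \<Q> P \<longleftrightarrow> (\<forall>Q\<in>\<Q>. t \<le> card (P \<inter> Q))"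

definition minimal_t_cover :: "nat \<Rightarrow> nat set set \<Rightarrow> nat set \<Rightarrow> bool" where
  "minimal_t_cover t \<Q> P \<longleftrightarrow> t_cover t \<Q> P \<and> (\<forall>P'. P' \<subset> P \<longrightarrow> \<not> t_cover t \<Q> P')"

text \<open>The binomial is a product of factors (a+i)/i, each at most a+1. The power form is chosen
  because bounds from successive branchings multiply to a single power.\<close>

lemma choose_add_le_power: "(a + j) choose j \<le> (a + 1) ^ j"
proof (induction j)
  case (Suc j)
  have "Suc j * ((a + Suc j) choose Suc j) = (a + Suc j) * ((a + j) choose j)"
    using Suc_times_binomial_eq[of "a + j" j] by (simp add: mult.commute)
  also have "\<dots> \<le> (Suc j * (a + 1)) * (a + 1) ^ j"
    using Suc by (intro mult_mono) auto
  also have "\<dots> = Suc j * (a + 1) ^ Suc j" by (simp only: power_Suc mult.assoc)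
  finally show ?case using mult_le_cancel1[of "Suc j"] by (metis zero_less_Suc)
qed auto

text \<open>A cover P containing S needs t points of Q, and S supplies all but j of them. So P
  contains some j-subset R of \<open>Q - S\<close>, and the covers are sorted by such an R.\<close>

lemma card_minimal_t_covers_branch:
  assumes Q: "Q \<in> \<Q>" "finite Q" and A: "finite A"
    and j: "card (S \<inter> Q) + j = t"
    and bound: "\<And>R. R \<subseteq> Q - S \<Longrightarrow> card R = j \<Longrightarrow>
      card {P \<in> [A]\<^bsup>q\<^esup>. S \<union> R \<subseteq> P \<and> minimal_t_cover t \<Q> P} \<le> b"
  shows "card {P \<in> [A]\<^bsup>q\<^esup>. S \<subseteq> P \<and> minimal_t_cover t \<Q> P} \<le> (card (Q - S) choose j) * b"
proof -
  let ?M = "\<lambda>S. {P \<in> [A]\<^bsup>q\<^esup>. S \<subseteq> P \<and> minimal_t_cover t \<Q> P}"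
  have fin: "finite ([A]\<^bsup>q\<^esup>)" using A by (simp add: finite_imp_finite_nsets)
  have fR: "finite ([Q - S]\<^bsup>j\<^esup>)" using Q by (simp add: finite_imp_finite_nsets)
  have "?M S \<subseteq> (\<Union>R\<in>[Q - S]\<^bsup>j\<^esup>. ?M (S \<union> R))"
  proof
    fix P assume P: "P \<in> ?M S"
    then have "t \<le> card (P \<inter> Q)" "finite P"
      using Q by (auto simp: minimal_t_cover_def t_cover_def nsets_def)
    moreover have "P \<inter> Q = (S \<inter> Q) \<union> (P \<inter> (Q - S))" using P by auto
    moreover have "card \<dots> \<le> card (S \<inter> Q) + card (P \<inter> (Q - S))" by (rule card_Un_le)
    ultimately have "j \<le> card (P \<inter> (Q - S))" using j by simp
    then obtain R where "R \<subseteq> P \<inter> (Q - S)" "card R = j" "finite R"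
      by (rule obtain_subset_with_card_n)
    then show "P \<in> (\<Union>R\<in>[Q - S]\<^bsup>j\<^esup>. ?M (S \<union> R))"
      using P by (auto simp: nsets_def)
  qed
  then have "card (?M S) \<le> card (\<Union>R\<in>[Q - S]\<^bsup>j\<^esup>. ?M (S \<union> R))"
    by (intro card_mono finite_UN_I) (auto simp: fin fR)
  also have "\<dots> \<le> (\<Sum>R\<in>[Q - S]\<^bsup>j\<^esup>. card (?M (S \<union> R)))"
    by (rule card_UN_le[OF fR])
  also have "\<dots> \<le> (\<Sum>R\<in>[Q - S]\<^bsup>j\<^esup>. b)"
    by (intro sum_mono bound) (auto simp: nsets_def)
  finally show ?thesis by simp
qed

text \<open>If S is itself a cover, minimality leaves only P = S. Otherwise some Q lacks j > 0
  points; then \<open>Q - S\<close> has at most (q-t)+j points, and the number of j-subsets is at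
  most \<open>(q - t + 1) ^ j\<close>, exactly the price for the j points by which S grows.\<close>

lemma card_minimal_t_covers_superset:
  assumes \<Q>: "\<And>Q. Q \<in> \<Q> \<Longrightarrow> finite Q \<and> card Q \<le> q" and A: "finite A" and "t \<le> q" and S: "finite S"
  shows "card {P \<in> [A]\<^bsup>q\<^esup>. S \<subseteq> P \<and> minimal_t_cover t \<Q> P} \<le> (q - t + 1) ^ (q - card S)"
  using S
proof (induction "q - card S" arbitrary: S rule: less_induct)
  case less
  let ?M = "\<lambda>S. {P \<in> [A]\<^bsup>q\<^esup>. S \<subseteq> P \<and> minimal_t_cover t \<Q> P}"
  show ?case
  proof (cases "t_cover t \<Q> S \<or> ?M S = {}")
    case True
    have "?M S \<subseteq> {S}"
    proof
      fix P assume P: "P \<in> ?M S"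
      then have "\<not> S \<subset> P" using True unfolding minimal_t_cover_def by blast
      with P show "P \<in> {S}" by blast
    qed
    then have "card (?M S) \<le> 1" using card_mono[of "{S}"] by fastforce
    then show ?thesis by (meson le_trans one_le_power le_add2)
  next
    case False
    then obtain Q where Q: "Q \<in> \<Q>" "card (S \<inter> Q) < t" by (auto simp: t_cover_def not_le)
    define j where "j = t - card (S \<inter> Q)"
    have j: "card (S \<inter> Q) + j = t" "j > 0" using Q by (auto simp: j_def)
    have cQ: "card (Q - S) \<le> (q - t) + j"
    proof -
      have "card (Q - S) = card Q - card (S \<inter> Q)"
        using \<Q>[OF Q(1)] by (simp add: card_Diff_subset_Int Int_commute)
      then show ?thesis using \<Q>[OF Q(1)] \<open>t \<le> q\<close> j by auto
    qed
    \<comment> \<open>The case assumption provides some P of size q containing S. This keeps the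
      exponent \<open>q - card S - j\<close> free of truncation, so that the two powers
      recombine.\<close>
    have Sj: "card S + j \<le> q"
    proof -
      from False obtain P where P: "P \<in> ?M S" by auto
      then have fP: "finite P" "card P = q" by (auto simp: nsets_def)
      have "t \<le> card (P \<inter> Q)" using P Q by (auto simp: minimal_t_cover_def t_cover_def)
      moreover have "P \<inter> Q = (S \<inter> Q) \<union> (P \<inter> Q - S)" using P by auto
      moreover have "card \<dots> \<le> card (S \<inter> Q) + card (P \<inter> Q - S)" by (rule card_Un_le)
      ultimately have "j \<le> card (P \<inter> Q - S)" using j by simp
      also have "\<dots> \<le> card (P - S)" using fP by (intro card_mono) auto
      also have "\<dots> = q - card S" using P fP less.prems by (auto simp: card_Diff_subset)
      finally show ?thesis using j by simp
    qed
    have "card (?M S) \<le> (card (Q - S) choose j) * (q - t + 1) ^ (q - card S - j)"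
    proof (rule card_minimal_t_covers_branch[OF Q(1) _ A j(1)])
      show "finite Q" using \<Q>[OF Q(1)] by simp
      fix R assume R: "R \<subseteq> Q - S" "card R = j"
      then have fR: "finite R" using \<Q>[OF Q(1)] finite_subset by blast
      then have "card (S \<union> R) = card S + j"
        using R less.prems by (subst card_Un_disjoint) auto
      then show "card (?M (S \<union> R)) \<le> (q - t + 1) ^ (q - card S - j)"
        using less.hyps[of "S \<union> R"] less.prems fR Sj j(2) by simp
    qed
    also have "\<dots> \<le> (q - t + 1) ^ j * (q - t + 1) ^ (q - card S - j)"
      using order.trans[OF binomial_right_mono[OF cQ] choose_add_le_power] by (rule mult_right_mono) simp
    also have "\<dots> = (q - t + 1) ^ (q - card S)"
      using Sj by (simp flip: power_add)
    finally show ?thesis .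
  qed
qed

text \<open>The branching starts at the empty set, where any Q lacks all t points: this gives the
  factor \<open>q choose t\<close>, and q - t points remain to be chosen. If there is no Q at all,
  the empty set is a cover, so no set of positive size is minimal.\<close>

lemma card_minimal_t_covers:
  assumes \<Q>: "\<And>Q. Q \<in> \<Q> \<Longrightarrow> finite Q \<and> card Q \<le> q" and A: "finite A" and "t \<le> q" "0 < q"
  shows "card {P \<in> [A]\<^bsup>q\<^esup>. minimal_t_cover t \<Q> P} \<le> (q choose t) * (q - t + 1) ^ (q - t)"
proof (cases "\<Q> = {}")
  case True
  have "\<not> minimal_t_cover t \<Q> P" if "P \<in> [A]\<^bsup>q\<^esup>" for P
  proof -
    have "{} \<subset> P" using that \<open>0 < q\<close> by (auto simp: nsets_def)
    then show ?thesis using True by (auto simp: minimal_t_cover_def t_cover_def)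
  qed
  then have "{P \<in> [A]\<^bsup>q\<^esup>. minimal_t_cover t \<Q> P} = {}" by auto
  then show ?thesis by (simp only: card.empty)
next
  case False
  then obtain Q where Q: "Q \<in> \<Q>" by auto
  have "card {P \<in> [A]\<^bsup>q\<^esup>. {} \<subseteq> P \<and> minimal_t_cover t \<Q> P}
      \<le> (card (Q - {}) choose t) * (q - t + 1) ^ (q - t)"
  proof (rule card_minimal_t_covers_branch[OF Q _ A])
    fix R assume R: "R \<subseteq> Q - {}" "card R = t"
    then have "finite R" using \<Q>[OF Q] finite_subset by blast
    then show "card {P \<in> [A]\<^bsup>q\<^esup>. {} \<union> R \<subseteq> P \<and> minimal_t_cover t \<Q> P} \<le> (q - t + 1) ^ (q - t)"
      using card_minimal_t_covers_superset[OF \<Q> A \<open>t \<le> q\<close>, of \<Q> R] R by simp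
  qed (use \<Q>[OF Q] in auto)
  also have "\<dots> \<le> (q choose t) * (q - t + 1) ^ (q - t)"
    using \<Q>[OF Q] by (intro mult_right_mono binomial_right_mono) auto
  finally show ?thesis by simp
qed

section \<open>Peeling\<close>

definition generated :: "nat \<Rightarrow> nat \<Rightarrow> nat set set \<Rightarrow> nat set set" where
  "generated n k \<P> = {F \<in> [{1..n}]\<^bsup>k\<^esup>. \<exists>P\<in>\<P>. P \<subseteq> F}"

lemma finite_generated [simp]: "finite (generated n k \<P>)"
  by (simp add: generated_def)

text \<open>A lost set F contains some P of size exactly q+1 but no cover of size at most q. Every
  proper subset of P is of that smaller size and lies in F, so P is a minimal cover. The lost sets
  are thus covered by the stars of the minimal covers.\<close>

lemma card_generated_peel:
  assumes \<Q>: "\<And>Q. Q \<in> \<Q> \<Longrightarrow> Q \<subseteq> {1..n} \<and> card Q \<le> Suc q"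
    and \<P>: "\<And>P. P \<in> \<P> \<Longrightarrow> P \<subseteq> {1..n} \<and> card P \<le> Suc q \<and> t_cover t \<Q> P"
    and tq: "t \<le> Suc q"
  shows "card (generated n k \<P> - generated n k {P. P \<subseteq> {1..n} \<and> card P \<le> q \<and> t_cover t \<Q> P})
    \<le> (Suc q choose t) * (Suc q - t + 1) ^ (Suc q - t) * ((n - Suc q) choose (k - Suc q))"
proof -
  let ?M = "{P \<in> [{1..n}]\<^bsup>(Suc q)\<^esup>. minimal_t_cover t \<Q> P}"
  have "generated n k \<P> - generated n k {P. P \<subseteq> {1..n} \<and> card P \<le> q \<and> t_cover t \<Q> P}
      \<subseteq> (\<Union>P\<in>?M. star n k P)"
  proof
    fix F assume F: "F \<in> generated n k \<P> - generated n k {P. P \<subseteq> {1..n} \<and> card P \<le> q \<and> t_cover t \<Q> P}"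
    then obtain P where P: "P \<in> \<P>" "P \<subseteq> F" and Fk: "F \<in> [{1..n}]\<^bsup>k\<^esup>" by (auto simp: generated_def)
    have none: False if "P' \<subseteq> F" "card P' \<le> q" "t_cover t \<Q> P'" for P'
    proof -
      have "P' \<subseteq> {1..n}" using that(1) Fk unfolding nsets_def by blast
      with that F Fk show False unfolding generated_def by blast
    qed
    have fP: "finite P" "card P \<le> Suc q" "P \<subseteq> {1..n}" using \<P>[OF P(1)] finite_subset by auto
    have cP: "card P = Suc q" using none[of P] P \<P>[OF P(1)] by (meson le_SucE)
    have "minimal_t_cover t \<Q> P"
      unfolding minimal_t_cover_def
    proof (intro conjI allI impI)
      show "t_cover t \<Q> P" using \<P>[OF P(1)] by simp
      fix P' assume "P' \<subset> P"
      moreover have "card P' < Suc q" using psubset_card_mono[OF fP(1) \<open>P' \<subset> P\<close>] cP by simp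
      ultimately show "\<not> t_cover t \<Q> P'" using none[of P'] P by auto
    qed
    then show "F \<in> (\<Union>P\<in>?M. star n k P)"
      using fP cP P Fk by (auto simp: star_def nsets_def)
  qed
  then have "card (generated n k \<P> - generated n k {P. P \<subseteq> {1..n} \<and> card P \<le> q \<and> t_cover t \<Q> P})
      \<le> card (\<Union>P\<in>?M. star n k P)"
    by (intro card_mono) auto
  also have "\<dots> \<le> card ?M * ((n - Suc q) choose (k - Suc q))"
    by (intro card_UN_star_le) (auto simp: nsets_def)
  also have "card ?M \<le> (Suc q choose t) * (Suc q - t + 1) ^ (Suc q - t)"
    by (rule card_minimal_t_covers) (use \<Q> tq in \<open>auto intro: finite_subset\<close>)
  finally show ?thesis by (simp add: mult_right_mono)
qed

text \<open>The induction runs on the size bound q: one peeling lowers it from q+1 to q, after which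
  the induction hypothesis applies to the peeled pair.\<close>

lemma cross_t_intersecting_peel:
  assumes "t + 1 \<le> q" and "cross_t_intersecting t \<P> \<Q>"
    and "\<And>P. P \<in> \<P> \<Longrightarrow> P \<subseteq> {1..n} \<and> card P \<le> q"
    and "\<And>Q. Q \<in> \<Q> \<Longrightarrow> Q \<subseteq> {1..n} \<and> card Q \<le> q"
  shows "\<exists>\<P>' \<Q>'. cross_t_intersecting t \<P>' \<Q>' \<and>
    (\<forall>P\<in>\<P>'. P \<subseteq> {1..n} \<and> card P \<le> t + 1) \<and> (\<forall>Q\<in>\<Q>'. Q \<subseteq> {1..n} \<and> card Q \<le> t + 1) \<and>
    card (generated n k \<P> - generated n k \<P>')
      \<le> (\<Sum>j=t+2..q. (j choose t) * (j - t + 1) ^ (j - t) * ((n - j) choose (k - j))) \<and>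
    card (generated n k \<Q> - generated n k \<Q>')
      \<le> (\<Sum>j=t+2..q. (j choose t) * (j - t + 1) ^ (j - t) * ((n - j) choose (k - j)))"
  using assms
proof (induction q arbitrary: \<P> \<Q> rule: dec_induct)
  case base
  then show ?case by (intro exI[of _ \<P>] exI[of _ \<Q>]) auto
next
  case (step q)
  define f where "f j = (j choose t) * (j - t + 1) ^ (j - t) * ((n - j) choose (k - j))" for j
  define \<P>1 where "\<P>1 = {P. P \<subseteq> {1..n} \<and> card P \<le> q \<and> t_cover t \<Q> P}"
  \<comment> \<open>The covers are those of \<open>\<P>1\<close>, not of \<open>\<P>\<close>: this
    makes the new pair cross t-intersecting again. Each member of \<open>\<Q>\<close> is still a
    cover of \<open>\<P>1\<close>, since the members of \<open>\<P>1\<close> cover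
    \<open>\<Q>\<close>, so the same loss bound applies on this side.\<close>
  define \<Q>1 where "\<Q>1 = {Q. Q \<subseteq> {1..n} \<and> card Q \<le> q \<and> t_cover t \<P>1 Q}"
  have "\<And>P. P \<in> \<P> \<Longrightarrow> t_cover t \<Q> P"
    using step.prems by (auto simp: cross_t_intersecting_def t_cover_def)
  then have lossP: "card (generated n k \<P> - generated n k \<P>1) \<le> f (Suc q)"
    unfolding \<P>1_def f_def using step by (intro card_generated_peel) auto
  have "\<And>Q. Q \<in> \<Q> \<Longrightarrow> t_cover t \<P>1 Q"
    by (auto simp: \<P>1_def t_cover_def Int_commute)
  then have lossQ: "card (generated n k \<Q> - generated n k \<Q>1) \<le> f (Suc q)"
    unfolding \<Q>1_def f_def using step by (intro card_generated_peel) (auto simp: \<P>1_def)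
  have "cross_t_intersecting t \<P>1 \<Q>1"
    by (auto simp: cross_t_intersecting_def \<Q>1_def t_cover_def Int_commute)
  moreover have "\<And>P. P \<in> \<P>1 \<Longrightarrow> P \<subseteq> {1..n} \<and> card P \<le> q" "\<And>Q. Q \<in> \<Q>1 \<Longrightarrow> Q \<subseteq> {1..n} \<and> card Q \<le> q"
    unfolding \<P>1_def \<Q>1_def by blast+
  ultimately obtain \<P>' \<Q>' where *: "cross_t_intersecting t \<P>' \<Q>'"
    "\<forall>P\<in>\<P>'. P \<subseteq> {1..n} \<and> card P \<le> t + 1" "\<forall>Q\<in>\<Q>'. Q \<subseteq> {1..n} \<and> card Q \<le> t + 1"
    "card (generated n k \<P>1 - generated n k \<P>') \<le> (\<Sum>j=t+2..q. f j)"
    "card (generated n k \<Q>1 - generated n k \<Q>') \<le> (\<Sum>j=t+2..q. f j)"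
    using step.IH[of \<P>1 \<Q>1] unfolding f_def[symmetric] by blast
  have sum: "(\<Sum>j=t+2..Suc q. f j) = (\<Sum>j=t+2..q. f j) + f (Suc q)"
    using step.hyps by simp
  \<comment> \<open>The new families may generate sets that the old ones did not, so the generated
    families need not be nested; the losses are added through differences of sets.\<close>
  have tri: "card (X - Z) \<le> card (Y - Z) + card (X - Y)"
    if "finite X" "finite Y" for X Y Z :: "nat set set"
  proof -
    have "card (X - Z) \<le> card ((Y - Z) \<union> (X - Y))" using that by (intro card_mono) auto
    also have "\<dots> \<le> card (Y - Z) + card (X - Y)" by (rule card_Un_le)
    finally show ?thesis .
  qed
  have "card (generated n k \<P> - generated n k \<P>') \<le> (\<Sum>j=t+2..Suc q. f j)"
    unfolding sum using tri[of "generated n k \<P>" "generated n k \<P>1" "generated n k \<P>'"] lossP *(4) by simp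
  moreover have "card (generated n k \<Q> - generated n k \<Q>') \<le> (\<Sum>j=t+2..Suc q. f j)"
    unfolding sum using tri[of "generated n k \<Q>" "generated n k \<Q>1" "generated n k \<Q>'"] lossQ *(5) by simp
  ultimately show ?case using * unfolding f_def by blast
qed

section \<open>Cross t-intersecting families of (t+1)-sets\<close>

lemma cross_t_intersecting_sym: "cross_t_intersecting t \<F> \<G> \<Longrightarrow> cross_t_intersecting t \<G> \<F>"
  unfolding cross_t_intersecting_def by (metis Int_commute)

lemma obtain_three_distinct:
  assumes "3 \<le> card \<A>"
  obtains A B C where "A \<in> \<A>" "B \<in> \<A>" "C \<in> \<A>" "A \<noteq> B" "A \<noteq> C" "B \<noteq> C"
proof -
  obtain \<T> where "\<T> \<subseteq> \<A>" "card \<T> = 3"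
    using obtain_subset_with_card_n[OF assms] by blast
  then show ?thesis using that card_3_iff[of \<T>] by auto
qed

text \<open>Each A is X plus one point. If B missed a point of X, all three extra points would have
  to lie in B, next to exactly t-1 points of X, which is one point too many for B.\<close>

lemma common_subset_of_cross:
  assumes X: "finite X" "card X = t"
    and A: "A1 \<noteq> A2" "A1 \<noteq> A3" "A2 \<noteq> A3"
      "\<And>A. A \<in> {A1, A2, A3} \<Longrightarrow> finite A \<and> card A = t + 1 \<and> X \<subseteq> A \<and> t \<le> card (A \<inter> B)"
    and B: "finite B" "card B = t + 1"
  shows "X \<subseteq> B"
proof (rule ccontr)
  assume "\<not> X \<subseteq> B"
  then have lt: "card (X \<inter> B) < t"
    using X by (metis inf.absorb_iff1 inf_le1 psubset_card_mono psubsetI)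
  have one: "\<exists>a. A = insert a X \<and> a \<notin> X \<and> a \<in> B \<and> Suc (card (X \<inter> B)) = t" if "A \<in> {A1, A2, A3}" for A
  proof -
    have A': "finite A" "card A = t + 1" "X \<subseteq> A" "t \<le> card (A \<inter> B)" using A(4)[OF that] by auto
    then have "card (A - X) = 1" using X by (simp add: card_Diff_subset)
    then obtain a where "A - X = {a}" by (rule card_1_singletonE)
    then have a: "A = insert a X" "a \<notin> X" using A' by auto
    have "a \<in> B" using a A'(4) lt by (metis Int_insert_left not_le)
    then have "card (A \<inter> B) = Suc (card (X \<inter> B))" using a X by simp
    then show ?thesis using a \<open>a \<in> B\<close> A'(4) lt by auto
  qed
  obtain a1 where a1: "A1 = insert a1 X" "a1 \<notin> X" "a1 \<in> B" "Suc (card (X \<inter> B)) = t"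
    using one[of A1] by blast
  obtain a2 where a2: "A2 = insert a2 X" "a2 \<notin> X" "a2 \<in> B" using one[of A2] by blast
  obtain a3 where a3: "A3 = insert a3 X" "a3 \<notin> X" "a3 \<in> B" using one[of A3] by blast
  note a = a1 a2 a3
  have "card ({a1, a2, a3} \<union> (X \<inter> B)) = card {a1, a2, a3} + card (X \<inter> B)"
    by (rule card_Un_disjoint) (use a X in auto)
  moreover have "card {a1, a2, a3} = 3"
  proof -
    have "a1 \<noteq> a2" "a1 \<noteq> a3" "a2 \<noteq> a3" using A(1-3) a by blast+
    then show ?thesis by simp
  qed
  moreover have "card ({a1, a2, a3} \<union> (X \<inter> B)) \<le> card B"
    by (rule card_mono) (use B a in auto)
  ultimately show False using B a by simp
qed

text \<open>Dual to the case of a common subset: each A is Z minus one point. If B left Z, it would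
  have at most t points in Z and could lose none of them in any A, so it would miss all three
  removed points and meet A1 in at most t-1 points.\<close>

lemma common_superset_of_cross:
  assumes Z: "finite Z" "card Z = t + 2"
    and A: "A1 \<noteq> A2" "A1 \<noteq> A3" "A2 \<noteq> A3"
      "\<And>A. A \<in> {A1, A2, A3} \<Longrightarrow> card A = t + 1 \<and> A \<subseteq> Z \<and> t \<le> card (A \<inter> B)"
    and B: "finite B" "card B = t + 1"
  shows "B \<subseteq> Z"
proof (rule ccontr)
  assume "\<not> B \<subseteq> Z"
  then have "B \<inter> Z \<subset> B" by blast
  then have le: "card (B \<inter> Z) \<le> t"
    using B psubset_card_mono[of B "B \<inter> Z"] by simp
  have one: "\<exists>z. A = Z - {z} \<and> z \<in> Z \<and> z \<notin> B" if "A \<in> {A1, A2, A3}" for A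
  proof -
    have A': "card A = t + 1" "A \<subseteq> Z" "t \<le> card (A \<inter> B)" using A(4)[OF that] by auto
    then have "card (Z - A) = 1" using Z by (simp add: card_Diff_subset finite_subset)
    then obtain z where z: "Z - A = {z}" by (rule card_1_singletonE)
    have "A \<inter> B = B \<inter> Z"
      by (rule card_seteq) (use A' B le in auto)
    then show ?thesis using z A' by blast
  qed
  obtain z1 where z1: "A1 = Z - {z1}" "z1 \<in> Z" "z1 \<notin> B" using one[of A1] by blast
  obtain z2 where z2: "A2 = Z - {z2}" "z2 \<in> Z" "z2 \<notin> B" using one[of A2] by blast
  obtain z3 where z3: "A3 = Z - {z3}" "z3 \<in> Z" "z3 \<notin> B" using one[of A3] by blast
  note z = z1 z2 z3
  have c3: "card {z1, z2, z3} = 3" using A(1-3) unfolding z by auto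
  have "t \<le> card (A1 \<inter> B)" using A(4) by simp
  also have "\<dots> \<le> card (Z - {z1, z2, z3})"
    by (rule card_mono) (use z1(1) z2(3) z3(3) z1(3) Z in blast)+
  also have "\<dots> = t + 2 - card {z1, z2, z3}"
    using z1(2) z2(2) z3(2) Z by (subst card_Diff_subset) auto
  also note c3
  finally have "t \<le> t + 2 - 3" .
  \<comment> \<open>For t = 0 the truncated difference would satisfy the previous inequality; three
    distinct points inside Z exclude that case.\<close>
  moreover have "card {z1, z2, z3} \<le> card Z" using z1(2) z2(2) z3(2) Z by (intro card_mono) auto
  ultimately show False using c3 Z by simp
qed

text \<open>Two subsets of B of size at least t overlap in at least t-1 points, and the overlap lies
  in \<open>A1 \<inter> A2\<close>, which has fewer than t points. So B contains this intersection,
  of size t-1, and its two other points come one from each side.\<close>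

lemma cross_of_far_pair:
  assumes "finite A1" "finite A2" "finite B" "card B = t + 1"
    and ge: "t \<le> card (A1 \<inter> B)" "t \<le> card (A2 \<inter> B)" and lt: "card (A1 \<inter> A2) < t"
  shows "Suc (card (A1 \<inter> A2)) = t \<and> (\<exists>x\<in>A1 - A2. \<exists>y\<in>A2 - A1. B = insert x (insert y (A1 \<inter> A2)))"
proof -
  define Y where "Y = A1 \<inter> A2"
  have fin: "finite Y" using assms by (simp add: Y_def)
  have "card (A1 \<inter> B) + card (A2 \<inter> B) = card ((A1 \<inter> B) \<union> (A2 \<inter> B)) + card ((A1 \<inter> B) \<inter> (A2 \<inter> B))"
    using assms by (intro card_Un_Int) auto
  moreover have "card ((A1 \<inter> B) \<union> (A2 \<inter> B)) \<le> card B" using assms by (intro card_mono) auto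
  moreover have "(A1 \<inter> B) \<inter> (A2 \<inter> B) = Y \<inter> B" by (auto simp: Y_def)
  ultimately have YB: "t \<le> Suc (card (Y \<inter> B))" using assms by simp
  have "card (Y \<inter> B) \<le> card Y" using fin by (intro card_mono) auto
  then have cY: "Suc (card Y) = t" and "card Y \<le> card (Y \<inter> B)" using YB lt by (auto simp: Y_def)
  then have "Y \<inter> B = Y" using fin by (intro card_seteq) auto
  then have YsB: "Y \<subseteq> B" by blast
  have ex: "\<exists>x\<in>A - Y. x \<in> B" if "t \<le> card (A \<inter> B)" for A
  proof (rule ccontr)
    assume "\<not> (\<exists>x\<in>A - Y. x \<in> B)"
    then have "card (A \<inter> B) \<le> card Y" using fin by (intro card_mono) auto
    then show False using that cY by simp
  qed
  obtain x y where xy: "x \<in> A1 - Y" "x \<in> B" "y \<in> A2 - Y" "y \<in> B" using ex ge by blast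
  then have "x \<noteq> y" by (auto simp: Y_def)
  have "insert x (insert y Y) = B"
  proof (rule card_seteq)
    show "card B \<le> card (insert x (insert y Y))" using xy \<open>x \<noteq> y\<close> fin cY assms by simp
  qed (use xy YsB assms in auto)
  then show ?thesis using cY xy by (auto simp: Y_def)
qed

text \<open>If A1 = Y+ab and A2 = Y+cd with |Y| = t-1, every B is Y plus one of the pairs ac, ad,
  bc, bd. Four members mean that all four occur, and they pin the first family down to A1 and A2,
  fewer than three.\<close>

lemma cross_uniform_pairwise:
  assumes \<A>: "\<And>A. A \<in> \<A> \<Longrightarrow> finite A \<and> card A = t + 1" and \<B>: "\<And>B. B \<in> \<B> \<Longrightarrow> finite B \<and> card B = t + 1"
    and cross: "cross_t_intersecting t \<A> \<B>" and "3 \<le> card \<A>" "4 \<le> card \<B>"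
    and A: "A1 \<in> \<A>" "A2 \<in> \<A>"
  shows "t \<le> card (A1 \<inter> A2)"
proof (rule ccontr)
  assume "\<not> t \<le> card (A1 \<inter> A2)"
  then have lt: "card (A1 \<inter> A2) < t" by simp
  define Y where "Y = A1 \<inter> A2"
  have fin: "finite A1" "finite A2" "card A1 = t + 1" "card A2 = t + 1" "finite Y" using \<A> A by (auto simp: Y_def)
  have far: "Suc (card Y) = t \<and> (\<exists>x\<in>A1 - A2. \<exists>y\<in>A2 - A1. B = insert x (insert y Y))" if "B \<in> \<B>" for B
    unfolding Y_def using cross A that \<B> fin lt
    by (intro cross_of_far_pair) (auto simp: cross_t_intersecting_def)
  have "\<B> \<noteq> {}" using assms by auto
  then have cY: "Suc (card Y) = t" using far by auto
  have "card (A1 - A2) = 2" "card (A2 - A1) = 2"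
    using fin cY by (auto simp: card_Diff_subset_Int Y_def Int_commute)
  then obtain a b c d where ab: "A1 - A2 = {a, b}" "a \<noteq> b" and cd: "A2 - A1 = {c, d}" "c \<noteq> d"
    by (meson card_2_iff)
  have dist: "a \<noteq> c" "a \<noteq> d" "b \<noteq> c" "b \<noteq> d" "a \<notin> Y" "b \<notin> Y" "c \<notin> Y" "d \<notin> Y"
    using ab(1) cd(1) unfolding Y_def by blast+
  have A12: "A1 = insert a (insert b Y)" "A2 = insert c (insert d Y)"
    using ab(1) cd(1) unfolding Y_def by blast+
  define ac ad bc bd where "ac = insert a (insert c Y)" and "ad = insert a (insert d Y)"
    and "bc = insert b (insert c Y)" and "bd = insert b (insert d Y)"
  note defs = ac_def ad_def bc_def bd_def
  have "\<B> \<subseteq> {ac, ad, bc, bd}" using far unfolding ab cd defs by blast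
  moreover have "card {ac, ad, bc, bd} \<le> 4" by (simp add: card_insert_if)
  ultimately have \<B>eq: "\<B> = {ac, ad, bc, bd}"
    using \<open>4 \<le> card \<B>\<close> by (intro card_seteq) auto
  have "\<A> \<subseteq> {A1, A2}"
  proof
    fix A3 assume A3: "A3 \<in> \<A>"
    then have ge: "\<And>B. B \<in> \<B> \<Longrightarrow> t \<le> card (B \<inter> A3)" using cross by (auto simp: cross_t_intersecting_def Int_commute)
    \<comment> \<open>The roles are now exchanged: \<open>ac\<close>, \<open>bd\<close> and
      \<open>ad\<close>, \<open>bc\<close> are far pairs in the second family. The first allows A3
      to use the pairs ab, ad, bc, cd, the second ab, ac, bd, cd; only ab and cd pass both
      tests.\<close>
    have inter: "ac \<inter> bd = Y" "ad \<inter> bc = Y" using dist ab(2) cd(2) by (auto simp: defs)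
    have diff: "ac - bd = {a, c}" "bd - ac = {b, d}" "ad - bc = {a, d}" "bc - ad = {b, c}"
      using dist ab(2) cd(2) by (auto simp: defs)
    have "\<exists>x\<in>ac - bd. \<exists>y\<in>bd - ac. A3 = insert x (insert y (ac \<inter> bd))"
    proof (rule conjunct2[OF cross_of_far_pair[where t = t]])
      show "finite ac" "finite bd" using fin(5) by (simp_all add: defs)
      show "finite A3" "card A3 = t + 1" using \<A>[OF A3] by auto
      show "t \<le> card (ac \<inter> A3)" "t \<le> card (bd \<inter> A3)" by (simp_all add: ge \<B>eq)
      show "card (ac \<inter> bd) < t" using cY by (simp add: inter)
    qed
    then have 1: "A3 = insert a (insert b Y) \<or> A3 = insert a (insert d Y) \<or> A3 = insert c (insert b Y) \<or> A3 = insert c (insert d Y)"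
      unfolding diff inter by blast
    have "\<exists>x\<in>ad - bc. \<exists>y\<in>bc - ad. A3 = insert x (insert y (ad \<inter> bc))"
    proof (rule conjunct2[OF cross_of_far_pair[where t = t]])
      show "finite ad" "finite bc" using fin(5) by (simp_all add: defs)
      show "finite A3" "card A3 = t + 1" using \<A>[OF A3] by auto
      show "t \<le> card (ad \<inter> A3)" "t \<le> card (bc \<inter> A3)" by (simp_all add: ge \<B>eq)
      show "card (ad \<inter> bc) < t" using cY by (simp add: inter)
    qed
    then have 2: "A3 = insert a (insert b Y) \<or> A3 = insert a (insert c Y) \<or> A3 = insert d (insert b Y) \<or> A3 = insert d (insert c Y)"
      unfolding diff inter by blast
    have 3: "b \<in> A3 \<or> c \<in> A3" "a \<in> A3 \<or> d \<in> A3" using 2 by blast+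
    from 1 show "A3 \<in> {A1, A2}"
    proof (elim disjE)
      assume "A3 = insert a (insert d Y)"
      then have "b \<notin> A3" "c \<notin> A3" using dist ab(2) cd(2) by auto
      with 3 show ?thesis by simp
    next
      assume "A3 = insert c (insert b Y)"
      then have "a \<notin> A3" "d \<notin> A3" using dist ab(2) cd(2) by auto
      with 3 show ?thesis by simp
    qed (simp_all add: A12)
  qed
  then have "card \<A> \<le> card {A1, A2}" by (rule card_mono[rotated]) simp
  also have "\<dots> \<le> 2" by (simp add: card_insert_if)
  finally show False using \<open>3 \<le> card \<A>\<close> by simp
qed

text \<open>Pairwise intersection is available only inside the family opposite the one with four
  members. Three of its sets either share a t-set or lie in a (t+2)-set; this passes to every B, and
  then from three of the B to every A.\<close>

lemma cross_uniform_structure: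
  assumes \<A>: "\<And>A. A \<in> \<A> \<Longrightarrow> A \<subseteq> V \<and> card A = t + 1" and \<B>: "\<And>B. B \<in> \<B> \<Longrightarrow> B \<subseteq> V \<and> card B = t + 1"
    and V: "finite V"
    and cross: "cross_t_intersecting t \<A> \<B>" and "3 \<le> card \<A>" "4 \<le> card \<B>"
  shows "(\<exists>X. X \<subseteq> V \<and> card X = t \<and> (\<forall>A\<in>\<A> \<union> \<B>. X \<subseteq> A)) \<or> (\<exists>Z. Z \<subseteq> V \<and> card Z = t + 2 \<and> (\<forall>A\<in>\<A> \<union> \<B>. A \<subseteq> Z))"
proof -
  have finA: "finite A" "card A = t + 1" if "A \<in> \<A> \<union> \<B>" for A
  proof -
    have "A \<subseteq> V \<and> card A = t + 1" using that \<A>[of A] \<B>[of A] by (elim UnE) simp_all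
    then show "finite A" "card A = t + 1" using finite_subset V by auto
  qed
  have cr: "t \<le> card (A \<inter> B)" "t \<le> card (B \<inter> A)" if "A \<in> \<A>" "B \<in> \<B>" for A B
    using that cross by (auto simp: cross_t_intersecting_def Int_commute)
  obtain A1 A2 A3 where A: "A1 \<in> \<A>" "A2 \<in> \<A>" "A3 \<in> \<A>" "A1 \<noteq> A2" "A1 \<noteq> A3" "A2 \<noteq> A3"
    using obtain_three_distinct[OF \<open>3 \<le> card \<A>\<close>] by blast
  have "3 \<le> card \<B>" using \<open>4 \<le> card \<B>\<close> by simp
  then obtain B1 B2 B3 where B: "B1 \<in> \<B>" "B2 \<in> \<B>" "B3 \<in> \<B>" "B1 \<noteq> B2" "B1 \<noteq> B3" "B2 \<noteq> B3"
    by (rule obtain_three_distinct)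
  have pw: "t \<le> card (A \<inter> A')" if "A \<in> \<A>" "A' \<in> \<A>" for A A'
    using cross_uniform_pairwise[OF _ _ cross assms(5,6) that] finA by blast
  define X Z where "X = A1 \<inter> A2" and "Z = A1 \<union> A2"
  have fin: "finite A1" "finite A2" "finite A3" "card A1 = t + 1" "card A2 = t + 1" "card A3 = t + 1" using A finA by auto
  have "\<not> A1 \<subseteq> A2" using A(4) card_seteq[of A2 A1] fin by auto
  then have "X \<subset> A1" by (auto simp: X_def)
  then have "card X < t + 1" using fin psubset_card_mono[of A1 X] by simp
  then have cX: "card X = t" using pw[OF A(1,2)] by (simp add: X_def)
  have cZ: "card Z = t + 2" using card_Un_Int[OF fin(1,2)] fin cX by (simp add: X_def Z_def)
  have sub: "X \<subseteq> V" "Z \<subseteq> V" using \<A>[OF A(1)] \<A>[OF A(2)] by (auto simp: X_def Z_def)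
  then have finXZ: "finite X" "finite Z" using V finite_subset by auto
  \<comment> \<open>If A3 has a point y outside \<open>A1 \<union> A2\<close>, its t other points
    must all lie in A1 and in A2, hence form X.\<close>
  have "X \<subseteq> A3 \<or> A3 \<subseteq> Z"
  proof (rule disjCI)
    assume "\<not> A3 \<subseteq> Z"
    then obtain y where y: "y \<in> A3" "y \<notin> Z" by blast
    have "A3 - {y} = A \<inter> A3" if "A \<in> {A1, A2}" for A
    proof (rule sym, rule card_seteq)
      show "A \<inter> A3 \<subseteq> A3 - {y}" using that y by (auto simp: Z_def)
      have "t \<le> card (A \<inter> A3)" using that pw A by auto
      then show "card (A3 - {y}) \<le> card (A \<inter> A3)" using y fin by simp
    qed (use fin in auto)
    then have e: "A3 - {y} = A1 \<inter> A3" "A3 - {y} = A2 \<inter> A3" by auto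
    then have "A3 - {y} \<subseteq> X" by (auto simp: X_def)
    then have "A3 - {y} = X" using finXZ cX y fin by (intro card_seteq) auto
    then show "X \<subseteq> A3" by blast
  qed
  then show ?thesis
  proof
    assume XA3: "X \<subseteq> A3"
    have B': "X \<subseteq> B'" if B': "B' \<in> \<B>" for B'
    proof (rule common_subset_of_cross[OF finXZ(1) cX A(4-6)])
      show "finite A \<and> card A = t + 1 \<and> X \<subseteq> A \<and> t \<le> card (A \<inter> B')" if "A \<in> {A1, A2, A3}" for A
        using that A(1-3) B' XA3 fin cr by (auto simp: X_def)
    qed (use finA B' in auto)
    have A': "X \<subseteq> A'" if A': "A' \<in> \<A>" for A'
    proof (rule common_subset_of_cross[OF finXZ(1) cX B(4-6)])
      show "finite B' \<and> card B' = t + 1 \<and> X \<subseteq> B' \<and> t \<le> card (B' \<inter> A')" if "B' \<in> {B1, B2, B3}" for B'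
        using B'[of B'] finA[of B'] cr(2)[of A' B'] that A' B(1-3) by blast
    qed (use finA A' in auto)
    show ?thesis using A' B' sub cX by blast
  next
    assume ZA3: "A3 \<subseteq> Z"
    have B': "B' \<subseteq> Z" if B': "B' \<in> \<B>" for B'
    proof (rule common_superset_of_cross[OF finXZ(2) cZ A(4-6)])
      show "card A = t + 1 \<and> A \<subseteq> Z \<and> t \<le> card (A \<inter> B')" if "A \<in> {A1, A2, A3}" for A
        using that A(1-3) B' ZA3 fin cr by (auto simp: Z_def)
    qed (use finA B' in auto)
    have A': "A' \<subseteq> Z" if A': "A' \<in> \<A>" for A'
    proof (rule common_superset_of_cross[OF finXZ(2) cZ B(4-6)])
      show "card B' = t + 1 \<and> B' \<subseteq> Z \<and> t \<le> card (B' \<inter> A')" if "B' \<in> {B1, B2, B3}" for B'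
        using B'[of B'] finA[of B'] cr(2)[of A' B'] that A' B(1-3) by blast
    qed (use finA A' in auto)
    show ?thesis using A' B' sub cZ by blast
  qed
qed

section \<open>Numerical estimates\<close>

text \<open>This is (1 + 1/(j+1))^(j+1) \<le> e \<le> 3. It controls the growth of the branching
  factor (j+1)^j from one cover size to the next.\<close>

lemma Suc_over_power_le: "real (j + 2) ^ (j + 1) \<le> 3 * real (j + 1) ^ (j + 1)"
proof -
  have "(1 + 1 / real (j + 1)) ^ (j + 1) \<le> exp 1"
    by (rule exp_ge_one_plus_x_over_n_power_n) auto
  also have "\<dots> \<le> 3" by (rule exp_le)
  finally have "(1 + 1 / real (j + 1)) ^ (j + 1) * real (j + 1) ^ (j + 1) \<le> 3 * real (j + 1) ^ (j + 1)"
    by (rule mult_right_mono) simp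
  also have "(1 + 1 / real (j + 1)) ^ (j + 1) * real (j + 1) ^ (j + 1) = real (j + 2) ^ (j + 1)"
  proof -
    have "(1 + 1 / real (j + 1)) * real (j + 1) = real (j + 2)" by (simp add: field_simps)
    then show ?thesis by (simp only: power_mult_distrib[symmetric])
  qed
  finally show ?thesis .
qed

locale large_ground_set =
  fixes n k t :: nat
  assumes k_ge: "t + 2 \<le> k" and t_ge: "2 \<le> t" and n_ge: "7 * (k - t + 1) * k\<^sup>2 \<le> n"
begin

text \<open>The unit of all later estimates: the number of k-sets through a (t+1)-subset of the
  ground set, taken as a real because it is multiplied by fractions.\<close>

definition d1 :: real where "d1 = real ((n - (t + 1)) choose (k - (t + 1)))"

definition d2 :: real where "d2 = real ((n - (t + 2)) choose (k - (t + 2)))"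

text \<open>The number of k-sets that contain a fixed t-set and meet a fixed v-set disjoint from it.\<close>

definition hit :: "nat \<Rightarrow> nat" where
  "hit v = ((n - t) choose (k - t)) - ((n - t - v) choose (k - t))"

lemma k_ge_4: "4 \<le> k" using k_ge t_ge by simp

lemma n_ge_k: "21 * k * k \<le> n" "84 * k \<le> n"
proof -
  have "3 * (7 * k\<^sup>2) \<le> (k - t + 1) * (7 * k\<^sup>2)" using k_ge by (intro mult_right_mono) auto
  also have "\<dots> = 7 * (k - t + 1) * k\<^sup>2" by (simp only: mult_ac)
  also note n_ge
  finally show 1: "21 * k * k \<le> n" by (simp add: power2_eq_square)
  have "84 * k \<le> 21 * k * k" using mult_right_mono[OF k_ge_4, of k] by simp
  with 1 show "84 * k \<le> n" by linarith
qed

text \<open>The quotient of the two binomials is (n-s)/(k-s), so the claim is that n - s is at least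
  7 k^2 (k-s).\<close>

lemma degree_ratio:
  assumes "t + 1 \<le> s" "s < k"
  shows "7 * real k ^ 2 * real ((n - Suc s) choose (k - Suc s)) \<le> real ((n - s) choose (k - s))"
proof -
  let ?D = "\<lambda>s. (n - s) choose (k - s)"
  have ns: "s < n" using assms n_ge_k(2) by simp
  \<comment> \<open>The factor k-t+1 in the bound on n splits as (k-s) + (s+1-t): the first part
    gives the ratio, the second absorbs the subtracted s.\<close>
  have "7 * k\<^sup>2 * (k - s) + 7 * k\<^sup>2 * (s + 1 - t) = 7 * (k - t + 1) * k\<^sup>2"
    using assms by (simp flip: add_mult_distrib2)
  then have "7 * k\<^sup>2 * (k - s) + 7 * k\<^sup>2 * (s + 1 - t) \<le> n" using n_ge by simp
  moreover have "s \<le> 7 * k\<^sup>2 * (s + 1 - t)"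
  proof -
    have "s \<le> k" using assms by simp
    also have "\<dots> \<le> k\<^sup>2" using k_ge_4 by (simp add: power2_eq_square)
    also have "\<dots> \<le> 7 * k\<^sup>2 * (s + 1 - t)" using assms by (cases "s + 1 - t") auto
    finally show ?thesis .
  qed
  ultimately have "7 * k\<^sup>2 * (k - s) \<le> n - s" by simp
  then have "7 * k\<^sup>2 * (k - s) * ?D (Suc s) \<le> (n - s) * ?D (Suc s)" by (rule mult_right_mono) simp
  also have "\<dots> = (k - s) * ?D s"
    using Suc_times_binomial_eq[of "n - Suc s" "k - Suc s"] assms ns by (simp add: Suc_diff_Suc mult.commute)
  finally have "(k - s) * (7 * k\<^sup>2 * ?D (Suc s)) \<le> (k - s) * ?D s" by (simp add: mult_ac)
  then have "7 * k\<^sup>2 * ?D (Suc s) \<le> ?D s" using assms by simp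
  then have "real (7 * k\<^sup>2 * ?D (Suc s)) \<le> real (?D s)" by (simp only: of_nat_le_iff)
  then show ?thesis by simp
qed

lemma d1_pos: "0 < d1"
  using k_ge n_ge_k(2) by (simp add: d1_def zero_less_binomial_iff)

lemma d2_nonneg: "0 \<le> d2" by (simp add: d2_def)

lemma k2_d2: "7 * (real k * real k * d2) \<le> d1"
  using degree_ratio[of "t + 1"] k_ge by (simp add: d1_def d2_def power2_eq_square)

lemma mult_d2_le:
  assumes "a \<le> real k * real k" shows "7 * (a * d2) \<le> d1"
  using k2_d2 mult_right_mono[OF assms d2_nonneg] by linarith

lemma k_d2: "28 * (real k * d2) \<le> d1"
proof -
  have "4 * real k \<le> real k * real k" using k_ge_4 by (intro mult_right_mono) auto
  from mult_d2_le[OF this] show ?thesis by simp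
qed

text \<open>By Pascal's rule, forbidding one more point removes only the sets through it, at most
  \<open>d2\<close> of them.\<close>

lemma choose_lower_bound:
  assumes "i + t + 1 \<le> n"
  shows "d1 - real i * d2 \<le> real ((n - (t + 1) - i) choose (k - (t + 1)))"
  using assms
proof (induction i)
  case (Suc i)
  have eq: "n - (t + 1) - i = Suc (n - (t + 2) - i)" "k - (t + 1) = Suc (k - (t + 2))"
    using Suc.prems k_ge by auto
  have "(n - (t + 1) - i) choose (k - (t + 1))
      = ((n - (t + 2) - i) choose (k - (t + 2))) + ((n - (t + 1) - Suc i) choose (k - (t + 1)))"
    unfolding eq binomial_Suc_Suc using Suc.prems by simp
  moreover have "real ((n - (t + 2) - i) choose (k - (t + 2))) \<le> d2"
    unfolding d2_def of_nat_le_iff by (rule binomial_right_mono) simp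
  ultimately show ?case using Suc by (simp add: algebra_simps)
qed (simp add: d1_def)

lemma hit_0 [simp]: "hit 0 = 0" by (simp add: hit_def)

lemma hit_Suc:
  assumes "v + t + 1 \<le> n"
  shows "hit (Suc v) = hit v + ((n - (t + 1) - v) choose (k - (t + 1)))"
proof -
  have eq: "n - t - v = Suc (n - (t + 1) - v)" "k - t = Suc (k - (t + 1))"
    using assms k_ge by auto
  have "(n - t - v) choose (k - t)
      = ((n - (t + 1) - v) choose (k - (t + 1))) + ((n - t - Suc v) choose (k - t))"
    unfolding eq binomial_Suc_Suc using assms by simp
  moreover have "(n - t - v) choose (k - t) \<le> (n - t) choose (k - t)"
    by (rule binomial_right_mono) simp
  ultimately show ?thesis by (simp add: hit_def)
qed

lemma hit_mono: "w \<le> v \<Longrightarrow> hit w \<le> hit v"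
  unfolding hit_def by (intro diff_le_mono2 binomial_right_mono) auto

text \<open>Each new point adds at least \<open>d1 - v * d2\<close> sets, where v points came before
  it. The total correction is at most v^2/2 times \<open>d2\<close>, and \<open>k2_d2\<close> turns
  k^2/2 times \<open>d2\<close> into \<open>d1 / 14\<close>.\<close>

lemma hit_ge:
  assumes "v \<le> k" shows "real v * d1 - d1 / 14 \<le> real (hit v)"
proof -
  have "real v * d1 - real v * real v * d2 / 2 \<le> real (hit v)"
    using assms
  proof (induction v)
    case (Suc v)
    have "v + t + 1 \<le> n" using Suc.prems k_ge n_ge_k(2) by simp
    then have "real (hit (Suc v)) \<ge> real (hit v) + (d1 - real v * d2)"
      using choose_lower_bound[of v] by (simp add: hit_Suc)
    moreover have "real v * d1 - real v * real v * d2 / 2 \<le> real (hit v)" using Suc by simp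
    moreover have "real (Suc v) * d1 - real (Suc v) * real (Suc v) * d2 / 2
        = real v * d1 - real v * real v * d2 / 2 + (d1 - real v * d2) - d2 / 2"
      by (simp add: field_simps)
    ultimately show ?case using d2_nonneg by linarith
  qed simp
  moreover have "7 * (real v * real v * d2) \<le> d1"
    using assms by (intro mult_d2_le mult_mono) auto
  ultimately show ?thesis by simp
qed

text \<open>The last point alone adds \<open>d1\<close> minus at most k times \<open>d2\<close>, and
  the latter is at most \<open>d1 / 28\<close> by \<open>k_d2\<close>.\<close>

lemma hit_gap:
  assumes "w < u" "u \<le> k" shows "real (hit w) + 27 / 28 * d1 \<le> real (hit u)"
proof -
  obtain v where v: "u = Suc v" using assms by (cases u) auto
  have vn: "v + t + 1 \<le> n" using v assms k_ge n_ge_k(2) by simp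
  have "real v * d2 \<le> real k * d2" using v assms d2_nonneg by (intro mult_right_mono) auto
  then have "real (hit v) + 27 / 28 * d1 \<le> real (hit u)"
    using choose_lower_bound[OF vn] k_d2 v vn by (simp add: hit_Suc)
  moreover have "hit w \<le> hit v" using v assms by (intro hit_mono) simp
  ultimately show ?thesis by simp
qed

text \<open>
  The bound for the number of k-sets lost with the covers of size $t+j$. It starts at
  $\frac{9}{14}$ \<^term>\<open>d1\<close> for $j=2$ and decays with ratio at most $\frac{3}{28}$, which is where
  $\frac{18}{25} = \frac{9}{14} / (1 - \frac{3}{28})$ comes from.
\<close>

definition peel_loss :: "nat \<Rightarrow> real" where
  "peel_loss j = real (((t + j) choose t) * (j + 1) ^ j * ((n - (t + j)) choose (k - (t + j))))"

text \<open>Here (j+1)^j is 9, the binomial is at most k^2/2, and \<open>d2\<close> is at most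
  \<open>d1\<close> divided by 7 k^2.\<close>

lemma peel_loss_2: "peel_loss 2 \<le> 9 / 14 * d1"
proof -
  have "2 * ((t + 2) choose 2) = (t + 2) * (t + 1)"
    using choose_two[of "t + 2"] by simp
  moreover have "(t + 2) choose t = (t + 2) choose 2" using binomial_symmetric[of t "t + 2"] by simp
  ultimately have "real (2 * ((t + 2) choose t)) = real ((t + 2) * (t + 1))" by simp
  also have "\<dots> \<le> real (k * k)" using k_ge by (simp only: of_nat_le_iff) (rule mult_mono, auto)
  finally have "2 * real ((t + 2) choose t) \<le> real k * real k" by simp
  from mult_d2_le[OF this] have "14 * (real ((t + 2) choose t) * d2) \<le> d1" by simp
  then show ?thesis by (simp add: peel_loss_def d2_def)
qed

text \<open>The binomial grows by (t+j+1)/(j+1) \<le> k/(j+1), the power by at most 3(j+1), and the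
  degree shrinks by 7 k^2. The product is 3/(7k), at most 3/28 as k \<ge> 4.\<close>

lemma peel_loss_Suc:
  assumes "2 \<le> j" "t + Suc j \<le> k"
  shows "peel_loss (Suc j) \<le> 3 / 28 * peel_loss j"
proof -
  let ?D = "\<lambda>s. real ((n - s) choose (k - s))"
  define C where "C j = real ((t + j) choose t)" for j
  have C: "real (j + 1) * C (Suc j) = real (t + Suc j) * C j"
  proof -
    have "Suc j * ((t + Suc j) choose Suc j) = (t + Suc j) * ((t + j) choose j)"
      using Suc_times_binomial_eq[of "t + j" j] by (simp add: mult.commute)
    moreover have "(t + i) choose t = (t + i) choose i" for i using binomial_symmetric[of t "t + i"] by simp
    ultimately have "Suc j * ((t + Suc j) choose t) = (t + Suc j) * ((t + j) choose t)" by (simp only:)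
    then show ?thesis unfolding C_def by (metis Suc_eq_plus1 of_nat_mult)
  qed
  have D: "7 * real k ^ 2 * ?D (t + Suc j) \<le> ?D (t + j)"
    using degree_ratio[of "t + j"] assms by simp
  have "real (j + 1) * C (Suc j) * real (j + 2) ^ (j + 1) * (7 * real k ^ 2 * ?D (t + Suc j))
      \<le> (real k * C j) * (3 * real (j + 1) ^ (j + 1)) * ?D (t + j)"
    using assms D Suc_over_power_le[of j] unfolding C
    by (intro mult_mono) (auto simp: C_def)
  moreover have "peel_loss (Suc j) = C (Suc j) * real (j + 2) ^ (j + 1) * ?D (t + Suc j)"
    by (simp add: peel_loss_def C_def del: power_Suc)
  moreover have "peel_loss j = C j * real (j + 1) ^ j * ?D (t + j)"
    by (simp add: peel_loss_def C_def)
  moreover have "real (j + 1) ^ (j + 1) = real (j + 1) * real (j + 1) ^ j" by simp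
  ultimately have "(real k * real (j + 1)) * (7 * real k * peel_loss (Suc j)) \<le> (real k * real (j + 1)) * (3 * peel_loss j)"
    by (simp only: power2_eq_square mult_ac)
  then have "7 * real k * peel_loss (Suc j) \<le> 3 * peel_loss j"
    using k_ge_4 by (subst (asm) mult_le_cancel_left_pos) auto
  moreover have "7 * 4 * peel_loss (Suc j) \<le> 7 * real k * peel_loss (Suc j)"
    using k_ge_4 by (intro mult_right_mono) (auto simp: peel_loss_def)
  ultimately show ?thesis by simp
qed

lemma peel_loss_sum_le:
  "real (\<Sum>j=t+2..k. (j choose t) * (j - t + 1) ^ (j - t) * ((n - j) choose (k - j))) \<le> 18 / 25 * d1"
proof -
  \<comment> \<open>The geometric series in a form stable under induction: the first summand, 3/28
    of the last loss, pays for the next loss, and 25/28 is 1 - 3/28.\<close>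
  have geometric: "peel_loss j * (3 / 28) + (\<Sum>i=2..j. peel_loss i) * (25 / 28) \<le> 9 / 14 * d1"
    if "2 \<le> j" "t + j \<le> k" for j
    using that
  proof (induction j rule: dec_induct)
    case base
    then show ?case using peel_loss_2 by simp
  next
    case (step j)
    then have "peel_loss (Suc j) \<le> 3 / 28 * peel_loss j" by (intro peel_loss_Suc) auto
    moreover have "(\<Sum>i=2..Suc j. peel_loss i) = (\<Sum>i=2..j. peel_loss i) + peel_loss (Suc j)"
      using step.hyps by simp
    moreover have "peel_loss j * (3 / 28) + (\<Sum>i=2..j. peel_loss i) * (25 / 28) \<le> 9 / 14 * d1"
      using step by simp
    ultimately show ?case by (simp only: distrib_right)
  qed
  have "real (\<Sum>j=t+2..k. (j choose t) * (j - t + 1) ^ (j - t) * ((n - j) choose (k - j)))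
      = (\<Sum>j=2+t..(k-t)+t. real ((j choose t) * (j - t + 1) ^ (j - t) * ((n - j) choose (k - j))))"
    using k_ge by (simp add: add.commute)
  also have "\<dots> = (\<Sum>i=2..k-t. peel_loss i)"
    unfolding sum.shift_bounds_cl_nat_ivl by (simp add: peel_loss_def add.commute)
  finally have eq: "real (\<Sum>j=t+2..k. (j choose t) * (j - t + 1) ^ (j - t) * ((n - j) choose (k - j)))
      = (\<Sum>i=2..k-t. peel_loss i)" .
  have "0 \<le> peel_loss (k - t)" by (simp add: peel_loss_def)
  moreover have "2 \<le> k - t" "t + (k - t) \<le> k" using k_ge by auto
  ultimately show ?thesis using geometric[of "k - t"] unfolding eq by simp
qed

end

section \<open>The two disjoint parts of \<open>L_family\<close>: sizes, diversity, and exceptional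
  families\<close>

definition L_star :: "nat \<Rightarrow> nat \<Rightarrow> nat set \<Rightarrow> nat set \<Rightarrow> nat set set" where
  "L_star n k X V = {F \<in> [{1..n}]\<^bsup>k\<^esup>. X \<subseteq> F \<and> F \<inter> (V - X) \<noteq> {}}"

definition L_rest :: "nat \<Rightarrow> nat \<Rightarrow> nat set \<Rightarrow> nat set \<Rightarrow> nat set set" where
  "L_rest n k X U = {F \<in> [{1..n}]\<^bsup>k\<^esup>. \<exists>x\<in>X. F \<inter> U = U - {x}}"

lemma L_family_eq: "L_family n k X U V = L_star n k X V \<union> L_rest n k X U"
  by (simp add: L_family_def L_star_def L_rest_def)

lemma finite_L_parts [simp]: "finite (L_star n k X V)" "finite (L_rest n k X U)"
  by (simp_all add: L_star_def L_rest_def)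

lemma choose_le_choose_add: "a choose b \<le> (a + i) choose (b + i)"
proof (induction i)
  case (Suc i)
  then show ?case by (simp add: trans_le_add1)
qed simp

lemma t_diversity_le:
  assumes "X \<in> [{1..n}]\<^bsup>t\<^esup>" "finite \<F>"
  shows "t_diversity n t \<F> \<le> card {F \<in> \<F>. \<not> X \<subseteq> F}"
proof -
  have "card {F \<in> \<F>. X \<subseteq> F} \<le> max_t_degree n t \<F>"
    unfolding max_t_degree_def using assms by (intro Max_ge) auto
  moreover have "card \<F> = card {F \<in> \<F>. X \<subseteq> F} + card {F \<in> \<F>. \<not> X \<subseteq> F}"
    using assms(2) by (subst card_Un_disjoint[symmetric]) (auto intro: arg_cong[where f = card])
  ultimately show ?thesis by (simp add: t_diversity_def)
qed

lemma max_t_degree_le: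
  assumes "t \<le> n" "\<And>S. S \<in> [{1..n}]\<^bsup>t\<^esup> \<Longrightarrow> card {F \<in> \<F>. S \<subseteq> F} \<le> b"
  shows "max_t_degree n t \<F> \<le> b"
proof -
  have "[{1..n}]\<^bsup>t\<^esup> \<noteq> {}" using assms(1) by (simp add: nsets_eq_empty_iff)
  then show ?thesis
    unfolding max_t_degree_def using assms(2) by (intro Max.boundedI) auto
qed

context large_ground_set
begin

text \<open>This will be the size of \<open>L_rest\<close> and the diversity of the extremal family.
  Writing \<open>k + 1\<close> first keeps the truncated subtraction exact at u = k-t+1, where the
  lower index is 0.\<close>

definition rest_size :: "nat \<Rightarrow> nat" where
  "rest_size u = t * ((n - t - u) choose (k + 1 - t - u))"

lemma card_star_d1: "card T = t + 1 \<Longrightarrow> real (card (star n k T)) \<le> d1"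
  using card_star_le[of n k T] by (simp add: d1_def)

lemma card_le_d2_cover:
  assumes "finite \<T>" "card \<T> \<le> k * k"
    and "\<And>T. T \<in> \<T> \<Longrightarrow> card T = t + 2"
    and "\<And>G. G \<in> \<K> \<Longrightarrow> G \<in> [{1..n}]\<^bsup>k\<^esup> \<and> (\<exists>T\<in>\<T>. T \<subseteq> G)"
  shows "7 * real (card \<K>) \<le> d1"
proof -
  have "\<K> \<subseteq> (\<Union>T\<in>\<T>. star n k T)" using assms(4) unfolding star_def by blast
  then have "card \<K> \<le> card (\<Union>T\<in>\<T>. star n k T)" using assms(1) by (intro card_mono) auto
  also have "\<dots> \<le> card \<T> * ((n - (t + 2)) choose (k - (t + 2)))" using assms by (intro card_UN_star_le)
  finally have "real (card \<K>) \<le> real (card \<T> * ((n - (t + 2)) choose (k - (t + 2))))" by (simp only: of_nat_le_iff)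
  then have "real (card \<K>) \<le> real (card \<T>) * d2" by (simp add: d2_def)
  moreover have "real (card \<T>) \<le> real k * real k" using assms(2) by (metis of_nat_le_iff of_nat_mult)
  ultimately show ?thesis using mult_d2_le[of "real (card \<T>)"] by linarith
qed

text \<open>At most k choices of y and then k of z give at most k^2 sets S+y+z. The list
  \<open>Q y\<close> may depend on y so that it can be a set chosen to avoid y.\<close>

lemma card_le_two_points:
  assumes S: "finite S" "card S = t" and P: "finite P" "card P \<le> k"
    and Q: "\<And>y. y \<in> P \<Longrightarrow> finite (Q y) \<and> card (Q y) \<le> k"
    and G: "\<And>G. G \<in> \<K> \<Longrightarrow> G \<in> [{1..n}]\<^bsup>k\<^esup> \<and> S \<subseteq> G \<and> (\<exists>y\<in>P - S. \<exists>z\<in>Q y - S. y \<noteq> z \<and> y \<in> G \<and> z \<in> G)"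
  shows "7 * real (card \<K>) \<le> d1"
proof (rule card_le_d2_cover)
  let ?I = "SIGMA y:P. Q y"
  \<comment> \<open>The condition on the size discards the degenerate pairs, those with y = z or
    with a point in S.\<close>
  let ?T = "{T \<in> (\<lambda>(y, z). insert y (insert z S)) ` ?I. card T = t + 2}"
  have I: "finite ?I" using P Q by (intro finite_SigmaI) auto
  show "finite ?T" using I by simp
  have "card ?T \<le> card ((\<lambda>(y, z). insert y (insert z S)) ` ?I)"
    using I by (intro card_mono) auto
  also have "\<dots> \<le> card ?I" using I by (rule card_image_le)
  also have "\<dots> = (\<Sum>y\<in>P. card (Q y))" using P Q by (intro card_SigmaI) auto
  also have "\<dots> \<le> (\<Sum>y\<in>P. k)" using Q by (intro sum_mono) auto
  also have "\<dots> \<le> k * k" using P by simp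
  finally show "card ?T \<le> k * k" .
  fix G' assume "G' \<in> \<K>"
  note G' = G[OF this, THEN conjunct1] G[OF this, THEN conjunct2, THEN conjunct1]
    G[OF this, THEN conjunct2, THEN conjunct2]
  then obtain y z where yz: "y \<in> P - S" "z \<in> Q y - S" "y \<noteq> z" "y \<in> G'" "z \<in> G'" by blast
  then have "card (insert y (insert z S)) = t + 2" using S by simp
  moreover have "insert y (insert z S) \<in> (\<lambda>(y, z). insert y (insert z S)) ` ?I"
    by (rule rev_image_eqI[of "(y, z)"]) (use yz in simp_all)
  ultimately have "insert y (insert z S) \<in> ?T" by simp
  moreover have "insert y (insert z S) \<subseteq> G'" using yz G'(2) by simp
  ultimately show "G' \<in> [{1..n}]\<^bsup>k\<^esup> \<and> (\<exists>T\<in>?T. T \<subseteq> G')"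
    using G'(1) by (intro conjI bexI[of _ "insert y (insert z S)"])
next
  fix T assume "T \<in> {T \<in> (\<lambda>(y, z). insert y (insert z S)) ` (SIGMA y:P. Q y). card T = t + 2}"
  then show "card T = t + 2" by simp
qed

lemma card_L_star:
  assumes "X \<subseteq> V" "V \<subseteq> {1..n}" "card X = t" "card V = t + v"
  shows "card (L_star n k X V) = hit v"
proof -
  have fin: "finite V" "finite X"
    using finite_subset[OF assms(2)] finite_subset[OF assms(1)] by simp_all
  have sub: "{F \<in> [{1..n}]\<^bsup>k\<^esup>. X \<subseteq> F \<and> F \<inter> (V - X) = {}} \<subseteq> {F \<in> [{1..n}]\<^bsup>k\<^esup>. X \<subseteq> F \<and> F \<inter> {} = {}}" by auto
  have "L_star n k X V = {F \<in> [{1..n}]\<^bsup>k\<^esup>. X \<subseteq> F \<and> F \<inter> {} = {}} - {F \<in> [{1..n}]\<^bsup>k\<^esup>. X \<subseteq> F \<and> F \<inter> (V - X) = {}}"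
    by (auto simp: L_star_def)
  then have "card (L_star n k X V) = card {F \<in> [{1..n}]\<^bsup>k\<^esup>. X \<subseteq> F \<and> F \<inter> {} = {}}
      - card {F \<in> [{1..n}]\<^bsup>k\<^esup>. X \<subseteq> F \<and> F \<inter> (V - X) = {}}"
    using card_Diff_subset[OF _ sub] by simp
  also have "card {F \<in> [{1..n}]\<^bsup>k\<^esup>. X \<subseteq> F \<and> F \<inter> {} = {}} = (n - t) choose (k - t)"
  proof -
    have "X \<subseteq> {1..n}" using assms by blast
    then show ?thesis using card_nsets_between[of "{1..n}" X "{}" k] assms(3) k_ge by simp
  qed
  also have "card {F \<in> [{1..n}]\<^bsup>k\<^esup>. X \<subseteq> F \<and> F \<inter> (V - X) = {}} = (n - t - v) choose (k - t)"
  proof -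
    have "X \<subseteq> {1..n}" "V - X \<subseteq> {1..n}" "X \<inter> (V - X) = {}" using assms by blast+
    moreover have "card (V - X) = v" using assms fin by (simp add: card_Diff_subset)
    ultimately show ?thesis using card_nsets_between[of "{1..n}" X "V - X" k] assms(3) k_ge by simp
  qed
  finally show ?thesis by (simp add: hit_def)
qed

lemma card_L_rest:
  assumes "X \<subseteq> U" "U \<subseteq> {1..n}" "card X = t" "card U = t + u" "1 \<le> u" "u \<le> k - t + 1"
  shows "card (L_rest n k X U) = rest_size u"
proof -
  have fin: "finite U" "finite X"
    using finite_subset[OF assms(2)] finite_subset[OF assms(1)] by simp_all
  let ?R = "\<lambda>x. {F \<in> [{1..n}]\<^bsup>k\<^esup>. U - {x} \<subseteq> F \<and> F \<inter> {x} = {}}"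
  have R: "card (?R x) = (n - t - u) choose (k + 1 - t - u)" if "x \<in> X" for x
  proof -
    have "x \<in> U" "U - {x} \<subseteq> {1..n}" "{x} \<subseteq> {1..n}" "(U - {x}) \<inter> {x} = {}" using that assms by blast+
    moreover from this have "card (U - {x}) = t + u - 1" using fin assms by simp
    moreover have "t + u - 1 \<le> k" using assms k_ge by simp
    ultimately have "card (?R x) = (n - (t + u - 1) - 1) choose (k - (t + u - 1))"
      using card_nsets_between[of "{1..n}" "U - {x}" "{x}" k] by simp
    moreover have "n - (t + u - 1) - 1 = n - t - u" "k - (t + u - 1) = k + 1 - t - u" using assms by auto
    ultimately show ?thesis by simp
  qed
  have "F \<inter> U = U - {x} \<longleftrightarrow> U - {x} \<subseteq> F \<and> F \<inter> {x} = {}" if "x \<in> X" for F x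
    using that assms(1) by blast
  then have "L_rest n k X U = (\<Union>x\<in>X. ?R x)" unfolding L_rest_def by blast
  then have "card (L_rest n k X U) = card (\<Union>x\<in>X. ?R x)" by simp
  also have "\<dots> = (\<Sum>x\<in>X. card (?R x))"
  proof (rule card_UN_disjoint)
    show "\<forall>x\<in>X. \<forall>y\<in>X. x \<noteq> y \<longrightarrow> ?R x \<inter> ?R y = {}"
    proof (intro ballI impI)
      fix x y assume "x \<in> X" "y \<in> X" "x \<noteq> y"
      then have "y \<in> U - {x}" using assms(1) by blast
      have False if "F \<in> ?R x \<inter> ?R y" for F
      proof -
        have "U - {x} \<subseteq> F" "y \<notin> F" using that by simp_all
        with \<open>y \<in> U - {x}\<close> show False by blast
      qed
      then show "?R x \<inter> ?R y = {}" by (rule equals0I)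
    qed
  qed (use fin in auto)
  finally show ?thesis using R assms by (simp add: rest_size_def)
qed

text \<open>Raising both indices of the binomial by u-3 does not decrease it and leads to n-t-3 over
  k-t-2, which is at most \<open>d2\<close>; the factor t is at most k.\<close>

lemma rest_size_le:
  assumes "3 \<le> u" "u \<le> k - t + 1" shows "28 * real (rest_size u) \<le> d1"
proof -
  define i where "i = u - 3"
  have le: "t + u \<le> n" using assms k_ge n_ge_k(2) by linarith
  have "(n - t - u) choose (k + 1 - t - u) \<le> (n - t - u + i) choose (k + 1 - t - u + i)"
    by (rule choose_le_choose_add)
  also have "k + 1 - t - u + i = k - (t + 2)" using assms by (simp add: i_def)
  also have "(n - t - u + i) choose (k - (t + 2)) \<le> (n - (t + 2)) choose (k - (t + 2))"
    using assms le by (intro binomial_right_mono) (simp add: i_def)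
  finally have "real ((n - t - u) choose (k + 1 - t - u)) \<le> d2" by (simp add: d2_def)
  then have "real (rest_size u) \<le> real k * d2"
    unfolding rest_size_def of_nat_mult using k_ge by (intro mult_mono) auto
  then show ?thesis using k_d2 by linarith
qed

lemma card_L_family:
  assumes "X \<subseteq> U \<inter> V" "U \<subseteq> {1..n}" "V \<subseteq> {1..n}" "card X = t" "card U = t + u" "card V = t + v"
    "1 \<le> u" "u \<le> k - t + 1"
  shows "card (L_family n k X U V) = hit v + rest_size u"
proof -
  have "L_star n k X V \<inter> L_rest n k X U = {}" using assms(1) by (auto simp: L_star_def L_rest_def)
  then show ?thesis
    using assms unfolding L_family_eq by (subst card_Un_disjoint) (auto simp: card_L_star card_L_rest)
qed

text \<open>The point is that X attains the maximum degree. Another t-set S has a point s outside X,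
  so a member through S contains X+s or lies in \<open>L_rest\<close>: at most (1 + 1/28)
  \<open>d1\<close> sets, less than \<open>hit 3\<close>.\<close>

lemma t_diversity_L_family:
  assumes X: "X \<subseteq> U \<inter> V" "U \<subseteq> {1..n}" "V \<subseteq> {1..n}" "card X = t" "card U = t + u" "card V = t + v"
    and u: "3 \<le> u" "u \<le> k - t + 1" and v: "3 \<le> v" "v \<le> k - t + 1"
  shows "t_diversity n t (L_family n k X U V) = rest_size u"
proof -
  let ?L = "L_family n k X U V"
  have fin: "finite X" using X finite_subset by (metis finite_atLeastAtMost le_infE)
  have Xn: "X \<in> [{1..n}]\<^bsup>t\<^esup>" using X fin by (auto simp: nsets_def)
  have cL: "card ?L = hit v + rest_size u" using X u by (intro card_L_family) auto
  have "{F \<in> ?L. X \<subseteq> F} = L_star n k X V"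
    using X(1) by (auto simp: L_family_eq L_star_def L_rest_def)
  then have dX: "card {F \<in> ?L. X \<subseteq> F} = hit v" using X by (simp add: card_L_star)
  have "max_t_degree n t ?L \<le> hit v"
  proof (rule max_t_degree_le)
    fix S assume S: "S \<in> [{1..n}]\<^bsup>t\<^esup>"
    show "card {F \<in> ?L. S \<subseteq> F} \<le> hit v"
    proof (cases "S = X")
      case False
      have "\<not> S \<subseteq> X" using False S X(4) fin card_seteq[of X S] by (auto simp: nsets_def)
      then obtain s where s: "s \<in> S" "s \<notin> X" by blast
      have "{F \<in> ?L. S \<subseteq> F} \<subseteq> star n k (insert s X) \<union> L_rest n k X U"
        using s by (auto simp: L_family_eq L_star_def star_def)
      then have "card {F \<in> ?L. S \<subseteq> F} \<le> card (star n k (insert s X) \<union> L_rest n k X U)"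
        by (intro card_mono) auto
      also have "\<dots> \<le> card (star n k (insert s X)) + card (L_rest n k X U)" by (rule card_Un_le)
      finally have "card {F \<in> ?L. S \<subseteq> F} \<le> card (star n k (insert s X)) + rest_size u"
        using X u by (simp add: card_L_rest)
      then have "real (card {F \<in> ?L. S \<subseteq> F}) \<le> d1 + real (rest_size u)"
        using card_star_d1[of "insert s X"] s fin X by simp
      also have "\<dots> \<le> real (hit 3)" using rest_size_le[OF u] hit_ge[of 3] k_ge_4 d1_pos by simp
      also have "\<dots> \<le> real (hit v)" using v hit_mono by simp
      finally show ?thesis by simp
    qed (simp add: dX)
  qed (use k_ge n_ge_k(2) in simp)
  moreover have "hit v \<le> max_t_degree n t ?L"
    unfolding dX[symmetric] max_t_degree_def using Xn by (intro Max_ge) auto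
  ultimately show ?thesis by (simp add: t_diversity_def cL)
qed

section \<open>Families inside the (t+1)-wise part of a (t+2)-set\<close>

lemma A_family_eq:
  assumes "Z \<subseteq> {1..n}"
  shows "A_family n k t Z = (\<Union>T\<in>[Z]\<^bsup>(t+1)\<^esup>. star n k T)"
proof -
  have fZ: "finite Z" using assms finite_subset by blast
  show ?thesis
  proof (intro equalityI subsetI)
    fix F assume F: "F \<in> A_family n k t Z"
    then obtain T where "T \<subseteq> F \<inter> Z" "card T = t + 1" "finite T"
      unfolding A_family_def by (auto elim: obtain_subset_with_card_n)
    with F show "F \<in> (\<Union>T\<in>[Z]\<^bsup>(t+1)\<^esup>. star n k T)" by (auto simp: nsets_def star_def A_family_def)
  next
    fix F assume "F \<in> (\<Union>T\<in>[Z]\<^bsup>(t+1)\<^esup>. star n k T)"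
    then obtain T where T: "T \<subseteq> Z" "card T = t + 1" "T \<subseteq> F" "F \<in> [{1..n}]\<^bsup>k\<^esup>" by (auto simp: nsets_def star_def)
    then have "card T \<le> card (F \<inter> Z)" using fZ by (intro card_mono) auto
    with T show "F \<in> A_family n k t Z" by (simp add: A_family_def)
  qed
qed

lemma card_nsets_succ: "finite Z \<Longrightarrow> card Z = t + 2 \<Longrightarrow> card ([Z]\<^bsup>(t+1)\<^esup>) = t + 2"
  using binomial_symmetric[of 1 "t + 2"] by (simp add: card_nsets)

text \<open>Suppose F meets Z in at most t points. At most two (t+1)-subsets T of Z still meet F in
  t points. A member of \<open>\<G>\<close> through any other T contains a further point of F, so at
  most (t+2)k \<le> k^2 sets T+y account for those. With the loss this leaves at most (18/25 + 2 +
  1/7) \<open>d1\<close> members, too few.\<close>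

lemma subset_A_family:
  assumes \<F>: "\<F> \<subseteq> [{1..n}]\<^bsup>k\<^esup>" and \<G>: "\<G> \<subseteq> [{1..n}]\<^bsup>k\<^esup>" and cross: "cross_t_intersecting t \<F> \<G>"
    and Z: "Z \<subseteq> {1..n}" "card Z = t + 2" and \<B>: "\<B> \<subseteq> [Z]\<^bsup>(t+1)\<^esup>"
    and loss: "real (card (\<G> - generated n k \<B>)) \<le> 18 / 25 * d1"
    and large: "3 * d1 - d1 / 14 \<le> real (card \<G>)"
  shows "\<F> \<subseteq> A_family n k t Z"
proof
  fix F assume F: "F \<in> \<F>"
  have fZ: "finite Z" using Z finite_subset by blast
  have fF: "finite F" "card F = k" using F \<F> by (auto simp: nsets_def)
  show "F \<in> A_family n k t Z"
  proof (rule ccontr)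
    assume "F \<notin> A_family n k t Z"
    then have FZ: "card (F \<inter> Z) \<le> t" using F \<F> by (auto simp: A_family_def)
    define good where "good = {T \<in> [Z]\<^bsup>(t+1)\<^esup>. t \<le> card (F \<inter> T)}"
    define bad where "bad = {G \<in> \<G>. \<exists>T\<in>[Z]\<^bsup>(t+1)\<^esup> - good. T \<subseteq> G}"
    have good: "finite good" "card good \<le> 2"
    proof -
      show "finite good" using fZ by (simp add: good_def)
      \<comment> \<open>A good T = Z-{z} contains all of \<open>F \<inter> Z\<close>, which
        therefore has exactly t points; so z lies in \<open>Z - F\<close>, a set of two
        points.\<close>
      have "good \<subseteq> (\<lambda>z. Z - {z}) ` (Z - F) \<and> card (Z - F) = 2" if "good \<noteq> {}"
      proof
        have T: "\<exists>z\<in>Z - F. T = Z - {z}" "card (F \<inter> Z) = t" if "T \<in> good" for T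
        proof -
          have T: "T \<subseteq> Z" "card T = t + 1" "t \<le> card (F \<inter> T)" using that by (auto simp: good_def nsets_def)
          have FT: "F \<inter> T = F \<inter> Z" by (rule card_seteq) (use T FZ fZ in auto)
          show "card (F \<inter> Z) = t" using T FZ unfolding FT by simp
          have "card (Z - T) = 1" using T Z fZ by (simp add: card_Diff_subset finite_subset)
          then obtain z where "Z - T = {z}" by (rule card_1_singletonE)
          then show "\<exists>z\<in>Z - F. T = Z - {z}" using FT T(1) by blast
        qed
        then show "good \<subseteq> (\<lambda>z. Z - {z}) ` (Z - F)" by blast
        show "card (Z - F) = 2"
          using that T(2) fZ Z by (auto simp: card_Diff_subset_Int Int_commute)
      qed
      then show "card good \<le> 2"
        using surj_card_le[of "Z - F" good "\<lambda>z. Z - {z}"] fZ by (cases "good = {}") auto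
    qed
    have "7 * real (card bad) \<le> d1"
    proof (rule card_le_d2_cover)
      let ?I = "SIGMA T:[Z]\<^bsup>(t+1)\<^esup>. F - T"
      have I: "finite ?I" using fZ fF by (intro finite_SigmaI) auto
      let ?T = "(\<lambda>(T, y). insert y T) ` ?I"
      show "finite ?T" using I by simp
      have "card ?T \<le> card ?I" using I by (rule card_image_le)
      also have "\<dots> = (\<Sum>T\<in>[Z]\<^bsup>(t+1)\<^esup>. card (F - T))" using fZ fF by (intro card_SigmaI) auto
      also have "\<dots> \<le> (\<Sum>T\<in>[Z]\<^bsup>(t+1)\<^esup>. k)" using fF by (intro sum_mono) (auto intro: card_mono)
      also have "\<dots> = (t + 2) * k" using card_nsets_succ[OF fZ Z(2)] by simp
      also have "\<dots> \<le> k * k" using k_ge by (intro mult_right_mono) auto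
      finally show "card ?T \<le> k * k" .
      show "card T = t + 2" if "T \<in> ?T" for T using that by (auto simp: nsets_def)
      fix G assume G: "G \<in> bad"
      then obtain T where T: "T \<in> [Z]\<^bsup>(t+1)\<^esup>" "T \<notin> good" "T \<subseteq> G" "G \<in> \<G>"
        by (auto simp: bad_def)
      then have "card (F \<inter> T) < t" by (auto simp: good_def)
      note T = T(1) this T(3,4)
      have "t \<le> card (F \<inter> G)" using cross F T by (auto simp: cross_t_intersecting_def)
      then have "\<not> F \<inter> G \<subseteq> F \<inter> T"
        using T(2) card_mono[of "F \<inter> T" "F \<inter> G"] fF by auto
      then obtain y where "y \<in> F - T" "y \<in> G" by blast
      then show "G \<in> [{1..n}]\<^bsup>k\<^esup> \<and> (\<exists>T\<in>?T. T \<subseteq> G)"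
        using T \<G> by (auto intro!: bexI[of _ "(T, y)"])
    qed
    moreover have "real (card (\<Union>T\<in>good. star n k T)) \<le> 2 * d1"
    proof -
      have "card (\<Union>T\<in>good. star n k T) \<le> card good * ((n - (t + 1)) choose (k - (t + 1)))"
        using good by (intro card_UN_star_le) (auto simp: good_def nsets_def)
      also have "\<dots> \<le> 2 * ((n - (t + 1)) choose (k - (t + 1)))" using good by (intro mult_right_mono) auto
      finally have "real (card (\<Union>T\<in>good. star n k T)) \<le> real (2 * ((n - (t + 1)) choose (k - (t + 1))))"
        by (simp only: of_nat_le_iff)
      then show ?thesis by (simp add: d1_def)
    qed
    moreover have "card \<G> \<le> card (\<G> - generated n k \<B>) + card (\<Union>T\<in>good. star n k T) + card bad"
    proof -
      have fG: "finite \<G>" using \<G> by (rule finite_subset) simp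
      have "\<G> \<subseteq> (\<G> - generated n k \<B>) \<union> (\<Union>T\<in>good. star n k T) \<union> bad"
      proof
        fix G assume G: "G \<in> \<G>"
        show "G \<in> (\<G> - generated n k \<B>) \<union> (\<Union>T\<in>good. star n k T) \<union> bad"
        proof (cases "G \<in> generated n k \<B>")
          case True
          then obtain T where T: "T \<in> \<B>" "T \<subseteq> G" by (auto simp: generated_def)
          show ?thesis
          proof (cases "T \<in> good")
            case True
            then show ?thesis using T G \<G> by (auto simp: star_def)
          next
            case False
            then have "G \<in> bad" using T G \<B> unfolding bad_def by blast
            then show ?thesis by blast
          qed
        qed (use G in blast)
      qed
      then have "card \<G> \<le> card ((\<G> - generated n k \<B>) \<union> (\<Union>T\<in>good. star n k T) \<union> bad)"
        using fG good by (intro card_mono) (auto simp: bad_def)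
      also have "\<dots> \<le> card (\<G> - generated n k \<B>) + card (\<Union>T\<in>good. star n k T) + card bad"
        by (meson add_mono_thms_linordered_semiring(3) card_Un_le le_trans)
      finally show ?thesis .
    qed
    ultimately have "7 * real (card \<G>) \<le> 7 * (18 / 25 * d1) + 7 * (2 * d1) + d1" using loss by linarith
    then show False using large d1_pos by simp
  qed
qed

lemma card_A_family_le:
  assumes "Z \<subseteq> {1..n}" "card Z = t + 2"
  shows "real (card (A_family n k t Z)) \<le> real (t + 2) * d1"
proof -
  have "finite Z" using assms finite_subset by blast
  moreover have "\<And>T. T \<in> [Z]\<^bsup>(t+1)\<^esup> \<Longrightarrow> card T = t + 1" by (simp add: nsets_def)
  ultimately have "card (A_family n k t Z) \<le> (t + 2) * ((n - (t + 1)) choose (k - (t + 1)))"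
    using card_UN_star_le[of "[Z]\<^bsup>(t+1)\<^esup>" "t + 1" n k] card_nsets_succ[of Z] assms(2)
    unfolding A_family_eq[OF assms(1)] by (simp del: card_nsets)
  then have "real (card (A_family n k t Z)) \<le> real ((t + 2) * ((n - (t + 1)) choose (k - (t + 1))))"
    by (simp only: of_nat_le_iff)
  then show ?thesis unfolding of_nat_mult d1_def .
qed

text \<open>A member through a t-set S inside Z contains S plus one of the two remaining points of
  Z. If S has a point s outside Z, the member contains T+s for one of the t+2 sets T, which gives at
  most \<open>d1 / 7\<close> members.\<close>

lemma t_diversity_A_subfamily:
  assumes Z: "Z \<subseteq> {1..n}" "card Z = t + 2" and \<F>: "\<F> \<subseteq> A_family n k t Z"
  shows "real (card \<F>) \<le> real (t_diversity n t \<F>) + 2 * d1"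
proof -
  have fZ: "finite Z" using Z finite_subset by blast
  have d1: "d1 = real ((n - (t + 1)) choose (k - (t + 1)))" by (rule d1_def)
  have "max_t_degree n t \<F> \<le> 2 * ((n - (t + 1)) choose (k - (t + 1)))"
  proof (rule max_t_degree_le)
    fix S assume S: "S \<in> [{1..n}]\<^bsup>t\<^esup>"
    then have fS: "finite S" "card S = t" by (auto simp: nsets_def)
    show "card {F \<in> \<F>. S \<subseteq> F} \<le> 2 * ((n - (t + 1)) choose (k - (t + 1)))"
    proof (cases "S \<subseteq> Z")
      case True
      have "{F \<in> \<F>. S \<subseteq> F} \<subseteq> (\<Union>T\<in>(\<lambda>z. insert z S) ` (Z - S). star n k T)"
      proof
        fix F assume F: "F \<in> {F \<in> \<F>. S \<subseteq> F}"
        then have FA: "F \<in> [{1..n}]\<^bsup>k\<^esup>" "t + 1 \<le> card (F \<inter> Z)" using \<F> by (auto simp: A_family_def)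
        then have "\<not> F \<inter> Z \<subseteq> S" using card_mono[of S "F \<inter> Z"] fS by auto
        then show "F \<in> (\<Union>T\<in>(\<lambda>z. insert z S) ` (Z - S). star n k T)"
          using F FA by (auto simp: star_def)
      qed
      then have "card {F \<in> \<F>. S \<subseteq> F} \<le> card (\<Union>T\<in>(\<lambda>z. insert z S) ` (Z - S). star n k T)"
        using fZ by (intro card_mono) auto
      also have "\<dots> \<le> card ((\<lambda>z. insert z S) ` (Z - S)) * ((n - (t + 1)) choose (k - (t + 1)))"
        using fZ fS by (intro card_UN_star_le) auto
      also have "card ((\<lambda>z. insert z S) ` (Z - S)) \<le> card (Z - S)" using fZ by (intro card_image_le) auto
      also have "card (Z - S) = 2" using True fS Z by (simp add: card_Diff_subset)
      finally show ?thesis by simp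
    next
      case False
      then obtain s where s: "s \<in> S" "s \<notin> Z" by blast
      have "7 * real (card {F \<in> \<F>. S \<subseteq> F}) \<le> d1"
      proof (rule card_le_d2_cover)
        let ?T = "insert s ` ([Z]\<^bsup>(t+1)\<^esup>)"
        show "finite ?T" using fZ by simp
        have "card ?T \<le> card ([Z]\<^bsup>(t+1)\<^esup>)" using fZ by (intro card_image_le) simp
        also have "\<dots> \<le> k * 1" using card_nsets_succ[OF fZ Z(2)] k_ge by (simp del: card_nsets)
        also have "\<dots> \<le> k * k" using k_ge_4 by (intro mult_left_mono) auto
        finally show "card ?T \<le> k * k" .
        show "card T' = t + 2" if T': "T' \<in> ?T" for T'
        proof -
          obtain T where T: "T' = insert s T" "T \<subseteq> Z" "finite T" "card T = t + 1" using T' by (auto simp: nsets_def)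
          then have "s \<notin> T" using s by blast
          then show ?thesis using T by simp
        qed
        show "F \<in> [{1..n}]\<^bsup>k\<^esup> \<and> (\<exists>T\<in>?T. T \<subseteq> F)" if F: "F \<in> {F \<in> \<F>. S \<subseteq> F}" for F
        proof -
          have "F \<in> (\<Union>T\<in>[Z]\<^bsup>(t+1)\<^esup>. star n k T)" using F \<F> unfolding A_family_eq[OF Z(1)] by blast
          then obtain T where T: "T \<in> [Z]\<^bsup>(t+1)\<^esup>" "T \<subseteq> F" "F \<in> [{1..n}]\<^bsup>k\<^esup>" unfolding star_def by blast
          moreover have "insert s T \<subseteq> F" using T F s by blast
          ultimately show ?thesis by blast
        qed
      qed
      then have "real (card {F \<in> \<F>. S \<subseteq> F}) \<le> 2 * d1" using d1_pos by simp
      then show ?thesis unfolding d1 by (simp flip: of_nat_le_iff[where 'a = real])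
    qed
  qed (use k_ge n_ge_k(2) in simp)
  then have "real (max_t_degree n t \<F>) \<le> 2 * d1" unfolding d1 by (simp flip: of_nat_le_iff[where 'a = real])
  then show ?thesis unfolding t_diversity_def by linarith
qed

end

section \<open>Families close to a star\<close>

context large_ground_set
begin

text \<open>The members of \<open>\<G>\<close> containing X number at least \<open>hit u\<close>
  minus 18/25 of \<open>d1\<close>. This is too many if some F misses two points of X, and too many
  if the sets F-X have fewer than u points in common. So each F misses one point of X and contains a
  common u-set W, and U is \<open>X \<union> W\<close>.\<close>

lemma outside_star_subset:
  assumes \<F>: "\<F> \<subseteq> [{1..n}]\<^bsup>k\<^esup>" and \<G>: "\<G> \<subseteq> [{1..n}]\<^bsup>k\<^esup>" and cross: "cross_t_intersecting t \<F> \<G>"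
    and X: "X \<subseteq> {1..n}" "card X = t" and u: "1 \<le> u" "u \<le> k - t + 1"
    and few: "real (card {G \<in> \<G>. \<not> X \<subseteq> G}) \<le> 18 / 25 * d1" and large: "hit u \<le> card \<G>"
  shows "\<exists>U. X \<subseteq> U \<and> U \<subseteq> {1..n} \<and> card U = t + u \<and> {F \<in> \<F>. \<not> X \<subseteq> F} \<subseteq> L_rest n k X U"
proof -
  define \<F>' where "\<F>' = {F \<in> \<F>. \<not> X \<subseteq> F}"
  define \<G>X where "\<G>X = {G \<in> \<G>. X \<subseteq> G}"
  have fX: "finite X" using finite_subset[OF X(1)] by simp
  have fG: "finite \<G>" using finite_subset[OF \<G>] by simp
  have uk: "u \<le> k" using u k_ge t_ge by linarith
  have cG: "card \<G> = card \<G>X + card {G \<in> \<G>. \<not> X \<subseteq> G}"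
    unfolding \<G>X_def using fG by (subst card_Un_disjoint[symmetric]) (auto intro: arg_cong[where f = card])
  have GX_large: "real (hit u) - 18 / 25 * d1 \<le> real (card \<G>X)" using few large cG by linarith
  have F': "finite F" "card F = k" "F \<subseteq> {1..n}" "card (F \<inter> X) < t" if "F \<in> \<F>'" for F
  proof -
    have "F \<in> [{1..n}]\<^bsup>k\<^esup>" "\<not> X \<subseteq> F" using that \<F> by (auto simp: \<F>'_def)
    then show "finite F" "card F = k" "F \<subseteq> {1..n}" by (auto simp: nsets_def)
    have "F \<inter> X \<subset> X" using \<open>\<not> X \<subseteq> F\<close> by blast
    then show "card (F \<inter> X) < t" using psubset_card_mono[OF fX] X by simp
  qed
  have meet: "t \<le> card (F \<inter> X) + card ((F \<inter> G) - X)" if "F \<in> \<F>'" "G \<in> \<G>" for F G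
  proof -
    have "t \<le> card (F \<inter> G)" using cross that by (auto simp: cross_t_intersecting_def \<F>'_def)
    also have "\<dots> \<le> card ((F \<inter> X) \<union> ((F \<inter> G) - X))" using F'(1)[OF that(1)] by (intro card_mono) auto
    also have "\<dots> \<le> card (F \<inter> X) + card ((F \<inter> G) - X)" by (rule card_Un_le)
    finally show ?thesis .
  qed
  \<comment> \<open>If F misses two points of X, every G containing X has two points of F outside X,
    so at most \<open>d1 / 7\<close> such G exist.\<close>
  have trace: "card (F \<inter> X) = t - 1" if F: "F \<in> \<F>'" for F
  proof (rule ccontr)
    assume "card (F \<inter> X) \<noteq> t - 1"
    then have le: "card (F \<inter> X) + 2 \<le> t" using F'(4)[OF F] by linarith
    have "7 * real (card \<G>X) \<le> d1"
    proof (rule card_le_two_points[OF fX X(2), of F "\<lambda>_. F"])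
      show "finite F" "card F \<le> k" "finite F \<and> card F \<le> k" using F'[OF F] by simp_all
      fix G assume G: "G \<in> \<G>X"
      then have "2 \<le> card ((F \<inter> G) - X)" using meet[OF F, of G] le by (simp add: \<G>X_def)
      then obtain T where "T \<subseteq> (F \<inter> G) - X" "card T = 2" using obtain_subset_with_card_n by metis
      then obtain y z where "y \<noteq> z" "y \<in> (F \<inter> G) - X" "z \<in> (F \<inter> G) - X" by (auto simp: card_2_iff)
      then show "G \<in> [{1..n}]\<^bsup>k\<^esup> \<and> X \<subseteq> G \<and> (\<exists>y\<in>F - X. \<exists>z\<in>F - X. y \<noteq> z \<and> y \<in> G \<and> z \<in> G)"
        using G \<G> unfolding \<G>X_def by blast
    qed
    moreover have "27 / 28 * d1 \<le> real (hit u)" using hit_gap[of 0 u] u uk by simp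
    ultimately show False using GX_large d1_pos by linarith
  qed
  obtain W where W: "card W = u" "W \<subseteq> {1..n} - X" "\<And>F. F \<in> \<F>' \<Longrightarrow> W \<subseteq> F"
  proof (cases "\<F>' = {}")
    case True
    have "u \<le> card ({1..n} - X)" using X fX uk k_ge n_ge_k(2) by (simp add: card_Diff_subset)
    then obtain W where "W \<subseteq> {1..n} - X" "card W = u" using obtain_subset_with_card_n by metis
    then show ?thesis using that True by blast
  next
    case False
    then obtain F0 where F0: "F0 \<in> \<F>'" by blast
    define I where "I = (\<Inter>F\<in>\<F>'. F - X)"
    have I_sub: "I \<subseteq> F - X" if "F \<in> \<F>'" for F using that unfolding I_def by blast
    have fI: "finite I" using finite_subset[OF I_sub[OF F0]] F'[OF F0] by simp
    have In: "I \<subseteq> {1..n} - X" using I_sub[OF F0] F'(3)[OF F0] by blast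
    have "u \<le> card I"
    proof (rule ccontr)
      assume "\<not> u \<le> card I"
      then have lt: "card I < u" by simp
      have "X \<subseteq> X \<union> I" "X \<union> I \<subseteq> {1..n}" "card (X \<union> I) = t + card I"
        using In X fX fI by (auto intro!: card_Un_disjoint[THEN trans])
      then have star: "card (L_star n k X (X \<union> I)) = hit (card I)" using X by (intro card_L_star) auto
      define \<K> where "\<K> = \<G>X - L_star n k X (X \<union> I)"
      \<comment> \<open>A set G through X that avoids I meets \<open>F0 - X\<close> in some y. Since
        y is not common to all F, some \<open>f y\<close> omits y, and G meets it in a second point
        outside X.\<close>
      have "\<forall>y. \<exists>F. y \<notin> I \<union> X \<longrightarrow> F \<in> \<F>' \<and> y \<notin> F" unfolding I_def using False by auto
      then obtain f where f: "\<And>y. y \<notin> I \<union> X \<Longrightarrow> f y \<in> \<F>' \<and> y \<notin> f y" by metis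
      define Q where "Q y = (if y \<in> I \<union> X then {} else f y)" for y
      have "7 * real (card \<K>) \<le> d1"
      proof (rule card_le_two_points[OF fX X(2), of F0 Q])
        show "finite F0" "card F0 \<le> k" using F'[OF F0] by simp_all
        show "finite (Q y) \<and> card (Q y) \<le> k" for y using f[of y] F'[of "f y"] by (simp add: Q_def)
        fix G assume G: "G \<in> \<K>"
        then have G': "G \<in> [{1..n}]\<^bsup>k\<^esup>" "X \<subseteq> G" "G \<in> \<G>" "G \<inter> I = {}"
          using \<G> In by (auto simp: \<K>_def \<G>X_def L_star_def)
        have ex: "\<exists>y\<in>F - X. y \<in> G" if F: "F \<in> \<F>'" for F
        proof -
          have "card ((F \<inter> G) - X) \<noteq> 0" using meet[OF F G'(3)] F'(4)[OF F] by linarith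
          then have "(F \<inter> G) - X \<noteq> {}" by (metis card.empty)
          then show ?thesis by blast
        qed
        obtain y where y: "y \<in> F0 - X" "y \<in> G" using ex[OF F0] by blast
        then have yI: "y \<notin> I \<union> X" using G'(4) by blast
        obtain z where z: "z \<in> f y - X" "z \<in> G" using ex f[OF yI] by blast
        have "y \<noteq> z" using z f[OF yI] by blast
        moreover have "z \<in> Q y - X" using z yI by (simp add: Q_def)
        ultimately show "G \<in> [{1..n}]\<^bsup>k\<^esup> \<and> X \<subseteq> G \<and> (\<exists>y\<in>F0 - X. \<exists>z\<in>Q y - X. y \<noteq> z \<and> y \<in> G \<and> z \<in> G)"
          using y z G'(1,2) by blast
      qed
      moreover have "card \<G>X \<le> card (L_star n k X (X \<union> I)) + card \<K>"
      proof -
        have "card \<G>X \<le> card (L_star n k X (X \<union> I) \<union> \<K>)"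
          using fG by (intro card_mono) (auto simp: \<K>_def \<G>X_def)
        also have "\<dots> \<le> card (L_star n k X (X \<union> I)) + card \<K>" by (rule card_Un_le)
        finally show ?thesis .
      qed
      moreover have "real (hit (card I)) + 27 / 28 * d1 \<le> real (hit u)" using hit_gap[OF lt uk] .
      ultimately show False using GX_large star d1_pos by linarith
    qed
    then obtain W where "W \<subseteq> I" "card W = u" using obtain_subset_with_card_n by metis
    then show ?thesis using that In I_sub by blast
  qed
  define U where "U = X \<union> W"
  have fW: "finite W" using finite_subset[OF W(2)] by simp
  have U: "X \<subseteq> U" "U \<subseteq> {1..n}" using W(2) X(1) by (auto simp: U_def)
  have "card U = card X + card W"
    unfolding U_def using W(2) fX fW by (intro card_Un_disjoint) auto
  then have cU: "card U = t + u" using W X by simp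
  have "\<F>' \<subseteq> L_rest n k X U"
  proof
    fix F assume F: "F \<in> \<F>'"
    have "card (X - F) = 1" using trace[OF F] X fX t_ge by (simp add: card_Diff_subset_Int Int_commute)
    then obtain x where "X - F = {x}" by (rule card_1_singletonE)
    then have "x \<in> X" "F \<inter> U = U - {x}" using W(2) W(3)[OF F] unfolding U_def by blast+
    moreover have "F \<in> [{1..n}]\<^bsup>k\<^esup>" using F \<F> unfolding \<F>'_def by blast
    ultimately show "F \<in> L_rest n k X U" unfolding L_rest_def by blast
  qed
  then show ?thesis using U cU unfolding \<F>'_def by blast
qed

lemma L_rest_member_avoiding:
  assumes U: "X \<subseteq> U" "U \<subseteq> {1..n}" "card X = t" "card U = t + u" "1 \<le> u" "u \<le> k - t + 1"
    and x: "x \<in> X" and B: "finite B" "card B \<le> 4 * k"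
  obtains F where "F \<in> L_rest n k X U" "F \<inter> U = U - {x}" "F \<inter> B \<subseteq> U - {x}"
proof -
  have fU: "finite U" using finite_subset[OF U(2)] by simp
  have "card ({1..n} - (U \<union> B)) \<ge> card {1..n} - card (U \<union> B)" by (rule diff_card_le_card_Diff) (use fU B in simp)
  moreover have "card (U \<union> B) \<le> card U + card B" by (rule card_Un_le)
  ultimately have "k + 1 - t - u \<le> card ({1..n} - (U \<union> B))" using U(4,6) B(2) k_ge n_ge_k(2) by simp
  then obtain R where R: "R \<subseteq> {1..n} - (U \<union> B)" "card R = k + 1 - t - u" "finite R"
    by (rule obtain_subset_with_card_n)
  define F where "F = (U - {x}) \<union> R"
  have xU: "x \<in> U" using x U by blast
  have FU: "F \<inter> U = U - {x}" and FB: "F \<inter> B \<subseteq> U - {x}" using R(1) by (auto simp: F_def)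
  have "card F = card (U - {x}) + card R"
    unfolding F_def using R fU by (intro card_Un_disjoint) auto
  then have "card F = k" using R fU xU U(4-6) k_ge by simp
  then have "F \<in> [{1..n}]\<^bsup>k\<^esup>" using R(1,3) U(2) fU by (auto simp: nsets_def F_def)
  then have "F \<in> L_rest n k X U" using FU x unfolding L_rest_def by blast
  then show ?thesis using that FU FB by blast
qed

lemma star_part_subset:
  assumes \<G>: "\<G> \<subseteq> [{1..n}]\<^bsup>k\<^esup>" and cross: "cross_t_intersecting t \<F> \<G>"
    and U: "X \<subseteq> U" "U \<subseteq> {1..n}" "card X = t" "card U = t + u" "1 \<le> u" "u \<le> k - t + 1"
    and rest: "L_rest n k X U \<subseteq> \<F>"
  shows "{G \<in> \<G>. X \<subseteq> G} \<subseteq> L_star n k X U"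
proof
  fix G assume "G \<in> {G \<in> \<G>. X \<subseteq> G}"
  then have G: "G \<in> \<G>" "X \<subseteq> G" "G \<in> [{1..n}]\<^bsup>k\<^esup>" using \<G> by auto
  have fX: "finite X" using U(3) t_ge card_ge_0_finite[of X] by simp
  show "G \<in> L_star n k X U"
  proof (rule ccontr)
    assume "G \<notin> L_star n k X U"
    then have GU: "G \<inter> U \<subseteq> X" using G unfolding L_star_def by blast
    have "X \<noteq> {}" using U(3) t_ge by auto
    then obtain x where x: "x \<in> X" by blast
    have "finite G" "card G \<le> 4 * k" using G(3) by (auto simp: nsets_def)
    then obtain F where F: "F \<in> L_rest n k X U" "F \<inter> G \<subseteq> U - {x}"
      using L_rest_member_avoiding[OF U x] by metis
    have "t \<le> card (F \<inter> G)" using cross F(1) rest G(1) by (auto simp: cross_t_intersecting_def)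
    also have "\<dots> \<le> card (X - {x})" using F(2) GU fX by (intro card_mono) auto
    also have "\<dots> < t" using x fX U(3) t_ge by simp
    finally show False by simp
  qed
qed

lemma large_parts_eq:
  assumes "{G \<in> \<G>. X \<subseteq> G} \<subseteq> L_star n k X U" "{G \<in> \<G>. \<not> X \<subseteq> G} \<subseteq> L_rest n k X V"
    and "card (L_star n k X U) + card (L_rest n k X V) \<le> card \<G>"
  shows "{G \<in> \<G>. X \<subseteq> G} = L_star n k X U" "{G \<in> \<G>. \<not> X \<subseteq> G} = L_rest n k X V"
    "\<G> = L_family n k X V U"
proof -
  have fin: "finite {G \<in> \<G>. X \<subseteq> G}" "finite {G \<in> \<G>. \<not> X \<subseteq> G}"
    using finite_subset[OF assms(1)] finite_subset[OF assms(2)] by simp_all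
  have eq: "\<G> = {G \<in> \<G>. X \<subseteq> G} \<union> {G \<in> \<G>. \<not> X \<subseteq> G}" by blast
  have "card \<G> = card {G \<in> \<G>. X \<subseteq> G} + card {G \<in> \<G>. \<not> X \<subseteq> G}"
    by (subst eq, rule card_Un_disjoint[OF fin]) blast
  moreover have "card {G \<in> \<G>. X \<subseteq> G} \<le> card (L_star n k X U)" "card {G \<in> \<G>. \<not> X \<subseteq> G} \<le> card (L_rest n k X V)"
    using assms(1,2) by (intro card_mono; simp)+
  ultimately have "card (L_star n k X U) \<le> card {G \<in> \<G>. X \<subseteq> G}" "card (L_rest n k X V) \<le> card {G \<in> \<G>. \<not> X \<subseteq> G}"
    using assms(3) by linarith+
  then show 1: "{G \<in> \<G>. X \<subseteq> G} = L_star n k X U" and 2: "{G \<in> \<G>. \<not> X \<subseteq> G} = L_rest n k X V"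
    using card_seteq[OF _ assms(1)] card_seteq[OF _ assms(2)] by simp_all
  show "\<G> = L_family n k X V U" unfolding L_family_eq using eq unfolding 1 2 .
qed

lemma extremal_structure:
  assumes \<F>: "\<F> \<subseteq> [{1..n}]\<^bsup>k\<^esup>" and \<G>: "\<G> \<subseteq> [{1..n}]\<^bsup>k\<^esup>" and cross: "cross_t_intersecting t \<F> \<G>"
    and U: "X \<subseteq> U" "U \<subseteq> {1..n}" "card X = t" "card U = t + u" "1 \<le> u" "u \<le> k - t + 1"
    and V: "X \<subseteq> V" "V \<subseteq> {1..n}" "card V = t + v" "1 \<le> v" "v \<le> k - t + 1"
    and restF: "{F \<in> \<F>. \<not> X \<subseteq> F} = L_rest n k X U" and restG: "{G \<in> \<G>. \<not> X \<subseteq> G} \<subseteq> L_rest n k X V"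
    and large: "hit v + rest_size u \<le> card \<F>" "hit u + rest_size v \<le> card \<G>"
  shows "\<F> = L_family n k X U V \<and> \<G> = L_family n k X V U \<and> t + 2 \<le> card (U \<inter> V)"
proof -
  note cards = card_L_star[OF U(1-4)] card_L_star[OF V(1,2) U(3) V(3)]
    card_L_rest[OF U] card_L_rest[OF V(1,2) U(3) V(3-5)]
  have crossGF: "cross_t_intersecting t \<G> \<F>" using cross by (rule cross_t_intersecting_sym)
  have "{G \<in> \<G>. X \<subseteq> G} \<subseteq> L_star n k X U"
    using restF by (intro star_part_subset[OF \<G> cross U]) blast
  from large_parts_eq[OF this restG] have G: "{G \<in> \<G>. \<not> X \<subseteq> G} = L_rest n k X V" "\<G> = L_family n k X V U"
    using large cards by simp_all
  have "{F \<in> \<F>. X \<subseteq> F} \<subseteq> L_star n k X V"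
    using G(1) by (intro star_part_subset[OF \<F> crossGF V(1,2) U(3) V(3-5)]) blast
  from large_parts_eq(3)[OF this] have F: "\<F> = L_family n k X U V"
    using large cards restF by simp
  obtain S where "S \<subseteq> X" "card S = 2" using obtain_subset_with_card_n[of 2 X] t_ge U(3) by auto
  then obtain x y where xy: "x \<in> X" "y \<in> X" "x \<noteq> y" by (auto simp: card_2_iff)
  have fin: "finite U" "finite V" using finite_subset[OF U(2)] finite_subset[OF V(2)] by simp_all
  have "card V \<le> 4 * k" using V(3,5) k_ge by linarith
  then obtain F1 where F1: "F1 \<in> L_rest n k X U" "F1 \<inter> U = U - {x}" "F1 \<inter> V \<subseteq> U - {x}"
    using L_rest_member_avoiding[OF U xy(1) fin(2)] by metis
  have fF1: "finite F1" "card F1 = k" using F1(1) by (auto simp: L_rest_def nsets_def)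
  have "card (U \<union> F1) \<le> card U + card F1" by (rule card_Un_le)
  then have "finite (U \<union> F1)" "card (U \<union> F1) \<le> 4 * k" using fin fF1 U(4,6) k_ge by auto
  then obtain G1 where G1: "G1 \<in> L_rest n k X V" "G1 \<inter> V = V - {y}" "G1 \<inter> (U \<union> F1) \<subseteq> V - {y}"
    using L_rest_member_avoiding[OF V(1,2) U(3) V(3-5) xy(2)] by metis
  have "F1 \<in> \<F>" "G1 \<in> \<G>" using F1(1) G1(1) restF G(1) by blast+
  then have "t \<le> card (F1 \<inter> G1)" using cross by (auto simp: cross_t_intersecting_def)
  also have "F1 \<inter> G1 \<subseteq> (U \<inter> V) - {x, y}" using F1 G1 by blast
  then have "card (F1 \<inter> G1) \<le> card ((U \<inter> V) - {x, y})" using fin by (intro card_mono) auto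
  also have "\<dots> = card (U \<inter> V) - 2"
    using xy U(1) V(1) fin by (subst card_Diff_subset) auto
  finally have "t \<le> card (U \<inter> V) - 2" .
  then have "t + 2 \<le> card (U \<inter> V)" using t_ge by linarith
  then show ?thesis using F G by blast
qed

section \<open>The two regimes\<close>

lemma star_regime:
  assumes \<F>: "\<F> \<subseteq> [{1..n}]\<^bsup>k\<^esup>" and \<G>: "\<G> \<subseteq> [{1..n}]\<^bsup>k\<^esup>" and cross: "cross_t_intersecting t \<F> \<G>"
    and X: "X \<subseteq> {1..n}" "card X = t" and u: "1 \<le> u" "u \<le> k - t + 1" and v: "1 \<le> v" "v \<le> k - t + 1"
    and fewF: "real (card {F \<in> \<F>. \<not> X \<subseteq> F}) \<le> 18 / 25 * d1"
    and fewG: "real (card {G \<in> \<G>. \<not> X \<subseteq> G}) \<le> 18 / 25 * d1"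
    and large: "hit v + rest_size u \<le> card \<F>" "hit u + rest_size v \<le> card \<G>"
  shows "t_diversity n t \<F> \<le> rest_size u \<and> t_diversity n t \<G> \<le> rest_size v \<and>
    (t_diversity n t \<F> = rest_size u \<or> t_diversity n t \<G> = rest_size v \<longrightarrow>
      (\<exists>U V. X \<subseteq> U \<and> X \<subseteq> V \<and> U \<subseteq> {1..n} \<and> V \<subseteq> {1..n} \<and> card U = t + u \<and> card V = t + v \<and>
        t + 2 \<le> card (U \<inter> V) \<and> \<F> = L_family n k X U V \<and> \<G> = L_family n k X V U))"
proof -
  have crossGF: "cross_t_intersecting t \<G> \<F>" using cross by (rule cross_t_intersecting_sym)
  obtain U where U: "X \<subseteq> U" "U \<subseteq> {1..n}" "card U = t + u" "{F \<in> \<F>. \<not> X \<subseteq> F} \<subseteq> L_rest n k X U"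
    using outside_star_subset[OF \<F> \<G> cross X u fewG] large by auto
  obtain V where V: "X \<subseteq> V" "V \<subseteq> {1..n}" "card V = t + v" "{G \<in> \<G>. \<not> X \<subseteq> G} \<subseteq> L_rest n k X V"
    using outside_star_subset[OF \<G> \<F> crossGF X v fewF] large by auto
  note cards = card_L_rest[OF U(1,2) X(2) U(3) u] card_L_rest[OF V(1,2) X(2) V(3) v]
  have Xn: "X \<in> [{1..n}]\<^bsup>t\<^esup>" using X finite_subset[OF X(1)] by (simp add: nsets_def)
  have fin: "finite \<F>" "finite \<G>" using finite_subset[OF \<F>] finite_subset[OF \<G>] by simp_all
  have divF: "t_diversity n t \<F> \<le> card {F \<in> \<F>. \<not> X \<subseteq> F}" "card {F \<in> \<F>. \<not> X \<subseteq> F} \<le> rest_size u"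
    using t_diversity_le[OF Xn fin(1)] card_mono[OF _ U(4)] cards by simp_all
  have divG: "t_diversity n t \<G> \<le> card {G \<in> \<G>. \<not> X \<subseteq> G}" "card {G \<in> \<G>. \<not> X \<subseteq> G} \<le> rest_size v"
    using t_diversity_le[OF Xn fin(2)] card_mono[OF _ V(4)] cards by simp_all
  have "\<F> = L_family n k X U V \<and> \<G> = L_family n k X V U \<and> t + 2 \<le> card (U \<inter> V)"
    if "t_diversity n t \<F> = rest_size u \<or> t_diversity n t \<G> = rest_size v"
    using that
  proof
    assume "t_diversity n t \<F> = rest_size u"
    then have "{F \<in> \<F>. \<not> X \<subseteq> F} = L_rest n k X U"
      using divF cards by (intro card_seteq[OF _ U(4)]) simp_all
    then show ?thesis
      using extremal_structure[OF \<F> \<G> cross U(1,2) X(2) U(3) u V(1-3) v _ V(4) large] by simp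
  next
    assume "t_diversity n t \<G> = rest_size v"
    then have "{G \<in> \<G>. \<not> X \<subseteq> G} = L_rest n k X V"
      using divG cards by (intro card_seteq[OF _ V(4)]) simp_all
    then show ?thesis
      using extremal_structure[OF \<G> \<F> crossGF V(1,2) X(2) V(3) v U(1-3) u _ U(4) large(2,1)]
      by (simp add: Int_commute)
  qed
  then show ?thesis using divF divG U(1-3) V(1-3) by (meson le_trans)
qed

lemma peeled_families:
  assumes \<F>: "\<F> \<subseteq> [{1..n}]\<^bsup>k\<^esup>" and \<G>: "\<G> \<subseteq> [{1..n}]\<^bsup>k\<^esup>" and cross: "cross_t_intersecting t \<F> \<G>"
  obtains \<A> \<B> where "\<A> \<subseteq> [{1..n}]\<^bsup>(t+1)\<^esup>" "\<B> \<subseteq> [{1..n}]\<^bsup>(t+1)\<^esup>" "cross_t_intersecting t \<A> \<B>"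
    "real (card (\<F> - generated n k \<A>)) \<le> 18 / 25 * d1" "real (card (\<G> - generated n k \<B>)) \<le> 18 / 25 * d1"
proof -
  have "\<exists>\<P> \<Q>. cross_t_intersecting t \<P> \<Q> \<and>
    (\<forall>P\<in>\<P>. P \<subseteq> {1..n} \<and> card P \<le> t + 1) \<and> (\<forall>Q\<in>\<Q>. Q \<subseteq> {1..n} \<and> card Q \<le> t + 1) \<and>
    card (generated n k \<F> - generated n k \<P>)
      \<le> (\<Sum>j=t+2..k. (j choose t) * (j - t + 1) ^ (j - t) * ((n - j) choose (k - j))) \<and>
    card (generated n k \<G> - generated n k \<Q>)
      \<le> (\<Sum>j=t+2..k. (j choose t) * (j - t + 1) ^ (j - t) * ((n - j) choose (k - j)))"
    by (rule cross_t_intersecting_peel[OF _ cross]) (use k_ge \<F> \<G> in \<open>auto simp: nsets_def\<close>)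
  then obtain \<P> \<Q> where PQ: "cross_t_intersecting t \<P> \<Q>"
    "\<forall>P\<in>\<P>. P \<subseteq> {1..n} \<and> card P \<le> t + 1" "\<forall>Q\<in>\<Q>. Q \<subseteq> {1..n} \<and> card Q \<le> t + 1"
    and loss: "card (generated n k \<F> - generated n k \<P>)
      \<le> (\<Sum>j=t+2..k. (j choose t) * (j - t + 1) ^ (j - t) * ((n - j) choose (k - j)))"
    "card (generated n k \<G> - generated n k \<Q>)
      \<le> (\<Sum>j=t+2..k. (j choose t) * (j - t + 1) ^ (j - t) * ((n - j) choose (k - j)))"
    by blast
  define up where "up \<P> = {T \<in> [{1..n}]\<^bsup>(t+1)\<^esup>. \<exists>P\<in>\<P>. P \<subseteq> T}" for \<P>
  have up_gen: "generated n k \<P> \<subseteq> generated n k (up \<P>)" if \<P>: "\<forall>P\<in>\<P>. P \<subseteq> {1..n} \<and> card P \<le> t + 1" for \<P>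
  proof
    fix F assume "F \<in> generated n k \<P>"
    then obtain P where P: "P \<in> \<P>" "P \<subseteq> F" and F: "F \<in> [{1..n}]\<^bsup>k\<^esup>" by (auto simp: generated_def)
    have "finite F" "card F = k" "F \<subseteq> {1..n}" using F by (auto simp: nsets_def)
    moreover have "card P \<le> t + 1" using P \<P> by blast
    ultimately obtain T where "P \<subseteq> T" "T \<subseteq> F" "card T = t + 1"
      using exists_subset_between[of P "t + 1" F] P(2) k_ge by auto
    moreover from this have "T \<in> [{1..n}]\<^bsup>(t+1)\<^esup>"
      using \<open>finite F\<close> \<open>F \<subseteq> {1..n}\<close> finite_subset by (auto simp: nsets_def)
    ultimately show "F \<in> generated n k (up \<P>)" using P(1) F unfolding generated_def up_def by blast
  qed
  have self: "\<F> - generated n k (up \<P>) \<subseteq> generated n k \<F> - generated n k \<P>"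
    if "\<F> \<subseteq> [{1..n}]\<^bsup>k\<^esup>" "\<forall>P\<in>\<P>. P \<subseteq> {1..n} \<and> card P \<le> t + 1" for \<F> \<P>
    using up_gen[OF that(2)] that(1) unfolding generated_def by blast
  have lossF: "real (card (\<F> - generated n k (up \<P>))) \<le> 18 / 25 * d1"
  proof -
    have "card (\<F> - generated n k (up \<P>)) \<le> card (generated n k \<F> - generated n k \<P>)"
      using self[OF \<F> PQ(2)] by (intro card_mono) auto
    then show ?thesis using loss(1) peel_loss_sum_le by linarith
  qed
  have lossG: "real (card (\<G> - generated n k (up \<Q>))) \<le> 18 / 25 * d1"
  proof -
    have "card (\<G> - generated n k (up \<Q>)) \<le> card (generated n k \<G> - generated n k \<Q>)"
      using self[OF \<G> PQ(3)] by (intro card_mono) auto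
    then show ?thesis using loss(2) peel_loss_sum_le by linarith
  qed
  have "t \<le> card (A \<inter> B)" if AB: "A \<in> up \<P>" "B \<in> up \<Q>" for A B
  proof -
    obtain P Q where "P \<in> \<P>" "P \<subseteq> A" "Q \<in> \<Q>" "Q \<subseteq> B" "finite A" using AB by (auto simp: up_def nsets_def)
    then have "t \<le> card (P \<inter> Q)" "card (P \<inter> Q) \<le> card (A \<inter> B)"
      using PQ(1) by (auto simp: cross_t_intersecting_def intro!: card_mono)
    then show ?thesis by linarith
  qed
  then have "cross_t_intersecting t (up \<P>) (up \<Q>)" by (simp add: cross_t_intersecting_def)
  moreover have "up \<P> \<subseteq> [{1..n}]\<^bsup>(t+1)\<^esup>" "up \<Q> \<subseteq> [{1..n}]\<^bsup>(t+1)\<^esup>" by (auto simp: up_def)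
  ultimately show ?thesis using that lossF lossG by blast
qed

lemma many_generators:
  assumes \<F>: "\<F> \<subseteq> [{1..n}]\<^bsup>k\<^esup>" and \<A>: "\<A> \<subseteq> [{1..n}]\<^bsup>(t+1)\<^esup>"
    and loss: "real (card (\<F> - generated n k \<A>)) \<le> 18 / 25 * d1" and large: "hit v \<le> card \<F>" and v: "v \<le> k"
  shows "v \<le> card \<A>"
proof -
  have fA: "finite \<A>" using finite_subset[OF \<A>] by simp
  have fF: "finite \<F>" using finite_subset[OF \<F>] by simp
  have gen: "generated n k \<A> = (\<Union>T\<in>\<A>. star n k T)" unfolding generated_def star_def by blast
  have "card \<F> \<le> card ((\<F> - generated n k \<A>) \<union> (\<Union>T\<in>\<A>. star n k T))"
    using fA fF unfolding gen by (intro card_mono) auto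
  also have "\<dots> \<le> card (\<F> - generated n k \<A>) + card (\<Union>T\<in>\<A>. star n k T)" by (rule card_Un_le)
  also have "card (\<Union>T\<in>\<A>. star n k T) \<le> card \<A> * ((n - (t + 1)) choose (k - (t + 1)))"
    using fA \<A> by (intro card_UN_star_le) (auto simp: nsets_def)
  finally have "real (card \<F>) \<le> real (card (\<F> - generated n k \<A>) + card \<A> * ((n - (t + 1)) choose (k - (t + 1))))"
    by (simp only: of_nat_le_iff)
  then have "real (card \<F>) \<le> 18 / 25 * d1 + real (card \<A>) * d1" using loss by (simp add: d1_def)
  moreover have "real v * d1 - d1 / 14 \<le> real (card \<F>)" using hit_ge[OF v] large by linarith
  ultimately have "(real v - 1 / 14 - 18 / 25) * d1 \<le> real (card \<A>) * d1" by (simp add: algebra_simps)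
  then have "real v - 1 / 14 - 18 / 25 \<le> real (card \<A>)" using d1_pos by simp
  then show ?thesis by linarith
qed

lemma cross_t_intersecting_dichotomy:
  assumes \<F>: "\<F> \<subseteq> [{1..n}]\<^bsup>k\<^esup>" and \<G>: "\<G> \<subseteq> [{1..n}]\<^bsup>k\<^esup>" and cross: "cross_t_intersecting t \<F> \<G>"
    and uv: "3 \<le> u" "u \<le> k" "3 \<le> v" "v \<le> k" "(u, v) \<noteq> (3, 3)"
    and large: "hit v \<le> card \<F>" "hit u \<le> card \<G>"
  shows "(\<exists>X. X \<subseteq> {1..n} \<and> card X = t \<and> real (card {F \<in> \<F>. \<not> X \<subseteq> F}) \<le> 18 / 25 * d1 \<and>
      real (card {G \<in> \<G>. \<not> X \<subseteq> G}) \<le> 18 / 25 * d1) \<or>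
    (\<exists>Z. Z \<subseteq> {1..n} \<and> card Z = t + 2 \<and> \<F> \<subseteq> A_family n k t Z \<and> \<G> \<subseteq> A_family n k t Z)"
proof -
  obtain \<A> \<B> where AB: "\<A> \<subseteq> [{1..n}]\<^bsup>(t+1)\<^esup>" "\<B> \<subseteq> [{1..n}]\<^bsup>(t+1)\<^esup>" "cross_t_intersecting t \<A> \<B>"
    and loss: "real (card (\<F> - generated n k \<A>)) \<le> 18 / 25 * d1" "real (card (\<G> - generated n k \<B>)) \<le> 18 / 25 * d1"
    by (rule peeled_families[OF \<F> \<G> cross])
  have vA: "v \<le> card \<A>" using many_generators[OF \<F> AB(1) loss(1) large(1) uv(4)] .
  have uB: "u \<le> card \<B>" using many_generators[OF \<G> AB(2) loss(2) large(2) uv(2)] .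
  have sets: "A \<subseteq> {1..n} \<and> card A = t + 1" if "A \<in> \<A> \<union> \<B>" for A
    using that AB(1,2) by (auto simp: nsets_def)
  have crossBA: "cross_t_intersecting t \<B> \<A>" using AB(3) by (rule cross_t_intersecting_sym)
  have "(\<exists>X. X \<subseteq> {1..n} \<and> card X = t \<and> (\<forall>A\<in>\<A> \<union> \<B>. X \<subseteq> A)) \<or>
    (\<exists>Z. Z \<subseteq> {1..n} \<and> card Z = t + 2 \<and> (\<forall>A\<in>\<A> \<union> \<B>. A \<subseteq> Z))"
  proof (cases "4 \<le> u")
    case True
    show ?thesis
      by (rule cross_uniform_structure[OF _ _ _ AB(3)]) (use sets vA uB uv True in auto)
  next
    case False
    then have "4 \<le> v" using uv by auto
    have "(\<exists>X. X \<subseteq> {1..n} \<and> card X = t \<and> (\<forall>A\<in>\<B> \<union> \<A>. X \<subseteq> A)) \<or>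
      (\<exists>Z. Z \<subseteq> {1..n} \<and> card Z = t + 2 \<and> (\<forall>A\<in>\<B> \<union> \<A>. A \<subseteq> Z))"
      by (rule cross_uniform_structure[OF _ _ _ crossBA]) (use sets vA uB uv \<open>4 \<le> v\<close> in auto)
    then show ?thesis by (simp only: Un_commute)
  qed
  then show ?thesis
  proof (elim disjE exE conjE)
    fix X assume X: "X \<subseteq> {1..n}" "card X = t" "\<forall>A\<in>\<A> \<union> \<B>. X \<subseteq> A"
    have le: "real (card {F \<in> \<H>. \<not> X \<subseteq> F}) \<le> 18 / 25 * d1"
      if "finite \<H>" "\<C> \<subseteq> \<A> \<union> \<B>" "real (card (\<H> - generated n k \<C>)) \<le> 18 / 25 * d1" for \<H> \<C>
    proof -
      have "{F \<in> \<H>. \<not> X \<subseteq> F} \<subseteq> \<H> - generated n k \<C>" using that(2) X(3) unfolding generated_def by blast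
      then have "card {F \<in> \<H>. \<not> X \<subseteq> F} \<le> card (\<H> - generated n k \<C>)" using that(1) by (intro card_mono) auto
      then show ?thesis using that(3) by linarith
    qed
    have "finite \<F>" "finite \<G>" using finite_subset[OF \<F>] finite_subset[OF \<G>] by simp_all
    then show ?thesis using X(1,2) le[OF _ _ loss(1)] le[OF _ _ loss(2)] by blast
  next
    fix Z assume Z: "Z \<subseteq> {1..n}" "card Z = t + 2" "\<forall>A\<in>\<A> \<union> \<B>. A \<subseteq> Z"
    have "\<A> \<subseteq> [Z]\<^bsup>(t+1)\<^esup>" "\<B> \<subseteq> [Z]\<^bsup>(t+1)\<^esup>" using Z(3) AB(1,2) by (auto simp: nsets_def)
    moreover have "3 * d1 - d1 / 14 \<le> real (card \<H>)" if "hit w \<le> card \<H>" "3 \<le> w" for \<H> :: "nat set set" and w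
      using hit_ge[of 3] hit_mono[OF that(2)] that(1) k_ge_4 by simp
    moreover have "cross_t_intersecting t \<G> \<F>" using cross by (rule cross_t_intersecting_sym)
    ultimately show ?thesis
      using subset_A_family[OF \<F> \<G> cross Z(1,2) _ loss(2)] subset_A_family[OF \<G> \<F> _ Z(1,2) _ loss(1)]
        large uv Z(1,2) by meson
  qed
qed

lemma A_regime:
  assumes Z: "Z \<subseteq> {1..n}" "card Z = t + 2" and \<F>: "\<F> \<subseteq> A_family n k t Z"
    and large: "hit v \<le> card \<F>" and v: "3 \<le> v" "v \<le> k" and u: "3 \<le> u" "u \<le> k - t + 1"
  shows "v \<le> t + 2" "rest_size u < t_diversity n t \<F>"
proof -
  have ge: "real v * d1 - d1 / 14 \<le> real (card \<F>)" using hit_ge[OF v(2)] large by linarith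
  have "finite (A_family n k t Z)" by (simp add: A_family_def)
  then have "card \<F> \<le> card (A_family n k t Z)" using \<F> by (intro card_mono) auto
  then have "real (card \<F>) \<le> real (t + 2) * d1" using card_A_family_le[OF Z] by linarith
  then have "(real v - 1 / 14) * d1 \<le> real (t + 2) * d1" using ge by (simp add: algebra_simps)
  then have "real v - 1 / 14 \<le> real (t + 2)" using d1_pos by simp
  then show "v \<le> t + 2" by linarith
  have "3 * d1 \<le> real v * d1" using v d1_pos by (intro mult_right_mono) auto
  then show "rest_size u < t_diversity n t \<F>"
    using ge t_diversity_A_subfamily[OF Z \<F>] rest_size_le[OF u] d1_pos by linarith
qed

end

theorem theorem1p12:
  fixes n k t u v :: nat and \<F> \<G> :: "nat set set"
  assumes "k \<ge> t + 2" and "t + 2 \<ge> 4"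
    and "n \<ge> 7 * (k - t + 1) * k ^ 2"
    and "\<F> \<subseteq> [{1..n}]\<^bsup>k\<^esup>" and "\<G> \<subseteq> [{1..n}]\<^bsup>k\<^esup>"
    and "cross_t_intersecting t \<F> \<G>"
    and "u \<in> {3..k - t + 1}" and "v \<in> {3..k - t + 1}" and "(u, v) \<noteq> (3, 3)"
    and "card \<F> \<ge> card (L_std n k t u v)"
    and "card \<G> \<ge> card (L_std n k t v u)"
  shows "((t_diversity n t \<F> \<le> t_diversity n t (L_std n k t u v) \<and>
          t_diversity n t \<G> \<le> t_diversity n t (L_std n k t v u)) \<or>
         (u \<le> t + 2 \<and> v \<le> t + 2 \<and>
          (\<exists>Z \<in> [{1..n}]\<^bsup>(t + 2)\<^esup>. \<F> \<subseteq> A_family n k t Z \<and> \<G> \<subseteq> A_family n k t Z))) \<and>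
         (t_diversity n t \<F> \<le> t_diversity n t (L_std n k t u v) \<and>
         t_diversity n t \<G> \<le> t_diversity n t (L_std n k t v u) \<and>
         (t_diversity n t \<F> = t_diversity n t (L_std n k t u v) \<or>
          t_diversity n t \<G> = t_diversity n t (L_std n k t v u)) \<longrightarrow>
         (\<exists>X \<in> [{1..n}]\<^bsup>t\<^esup>. \<exists>U \<in> [{1..n}]\<^bsup>(t + u)\<^esup>. \<exists>V \<in> [{1..n}]\<^bsup>(t + v)\<^esup>.
            X \<subseteq> U \<inter> V \<and> card (U \<inter> V) \<ge> t + 2 \<and>
            \<F> = L_family n k X U V \<and> \<G> = L_family n k X V U))"
proof -
  interpret large_ground_set n k t
    using assms(1-3) by unfold_locales auto
  have uv: "3 \<le> u" "u \<le> k - t + 1" "3 \<le> v" "v \<le> k - t + 1" using assms(7,8) by auto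
  have uvk: "u \<le> k" "v \<le> k" using uv assms(1,2) by auto
  have sub: "{1..t + u} \<subseteq> {1..n}" "{1..t + v} \<subseteq> {1..n}" using uvk k_ge n_ge_k(2) by auto
  have card_L: "card (L_std n k t u v) = hit v + rest_size u" "card (L_std n k t v u) = hit u + rest_size v"
    unfolding L_std_def using uv sub by (intro card_L_family; simp)+
  have div_L: "t_diversity n t (L_std n k t u v) = rest_size u" "t_diversity n t (L_std n k t v u) = rest_size v"
    unfolding L_std_def using uv sub by (intro t_diversity_L_family; simp)+
  have large: "hit v + rest_size u \<le> card \<F>" "hit u + rest_size v \<le> card \<G>"
    using assms(10,11) card_L by simp_all
  have nsetsI: "S \<in> [{1..n}]\<^bsup>s\<^esup>" if "S \<subseteq> {1..n}" "card S = s" for S s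
    using that finite_subset[OF that(1)] by (simp add: nsets_def)
  have "hit v \<le> card \<F>" "hit u \<le> card \<G>" using large by simp_all
  from cross_t_intersecting_dichotomy[OF assms(4-6) uv(1) uvk(1) uv(3) uvk(2) assms(9) this]
  show ?thesis
  proof (elim disjE exE conjE)
    fix X assume X: "X \<subseteq> {1..n}" "card X = t"
      "real (card {F \<in> \<F>. \<not> X \<subseteq> F}) \<le> 18 / 25 * d1" "real (card {G \<in> \<G>. \<not> X \<subseteq> G}) \<le> 18 / 25 * d1"
    have "1 \<le> u" "1 \<le> v" using uv by simp_all
    note regime = star_regime[OF assms(4-6) X(1,2) \<open>1 \<le> u\<close> uv(2) \<open>1 \<le> v\<close> uv(4) X(3,4) large]
    have form: "\<exists>X \<in> [{1..n}]\<^bsup>t\<^esup>. \<exists>U \<in> [{1..n}]\<^bsup>(t + u)\<^esup>. \<exists>V \<in> [{1..n}]\<^bsup>(t + v)\<^esup>.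
            X \<subseteq> U \<inter> V \<and> card (U \<inter> V) \<ge> t + 2 \<and> \<F> = L_family n k X U V \<and> \<G> = L_family n k X V U"
      if eq: "t_diversity n t \<F> = rest_size u \<or> t_diversity n t \<G> = rest_size v"
    proof -
      obtain U V where UV: "X \<subseteq> U" "X \<subseteq> V" "U \<subseteq> {1..n}" "V \<subseteq> {1..n}" "card U = t + u" "card V = t + v"
        "t + 2 \<le> card (U \<inter> V)" "\<F> = L_family n k X U V" "\<G> = L_family n k X V U"
        using regime[THEN conjunct2, THEN conjunct2, rule_format, OF eq] by (elim exE conjE)
      have "X \<subseteq> U \<inter> V" using UV(1,2) by simp
      then show ?thesis
        using nsetsI[OF X(1,2)] nsetsI[OF UV(3,5)] nsetsI[OF UV(4,6)] UV(7-9) by blast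
    qed
    show ?thesis
      unfolding div_L by (intro conjI impI disjI1 regime[THEN conjunct1] regime[THEN conjunct2, THEN conjunct1])
        (elim conjE, rule form)
  next
    fix Z assume Z: "Z \<subseteq> {1..n}" "card Z = t + 2" "\<F> \<subseteq> A_family n k t Z" "\<G> \<subseteq> A_family n k t Z"
    have "v \<le> t + 2" "rest_size u < t_diversity n t \<F>"
      using A_regime[OF Z(1-3) _ uv(3) uvk(2) uv(1,2)] large by simp_all
    moreover have "u \<le> t + 2"
      using A_regime(1)[OF Z(1,2,4) _ uv(1) uvk(1) uv(3,4)] large by simp
    ultimately show ?thesis unfolding div_L using nsetsI[OF Z(1,2)] Z(3,4) by auto
  qed
qed

end
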